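(* For any $n\in\mathbb{Z}_{\ge 1}$ and any $r\in\mathbb{R}$ define $$\mathcal{P}_{n,r}=\left\{P\in \mathbb{Z}[X]~\middle|~\deg P=n,~ h_B(P)\le r\right\}.$$ Let $(r_n)_{n\in\mathbb{Z}_{\ge 1}}$ be any sequence of real numbers. (i) If $r_n$ converges to a value $\tau\in (0,\infty)$, then $$\lim_{n\to \infty} \frac{1}{\#\mathcal{P}_{n,r_n}}\sum_{P\in \mathcal{P}_{n,r_n}} \left|\tau+\tfrac{1}{2}-h_{\mathrm{FS}}(P)\right|=0.$$ (ii) If $0<\liminf_{n\to \infty} r_n\le \limsup_{n\to \infty} r_n<\infty$, then for any continuous function $f\colon \mathbb{C}\to\mathbb{C}$ such that $\lim_{|z|\to\infty}f(z)$ exists and is finite, it holds $$\lim_{n\to \infty} \frac{1}{\#\mathcal{P}_{n,r_n}}\sum_{P\in \mathcal{P}_{n,r_n}} \left|\frac{1}{n}\sum_{\substack{z\in\mathbb{C}\\ P(z)=0}}f(z)-\frac{i}{2\pi}\int_\mathbb{C}f(z)\frac{dz\wedge d\overline{z}}{\left(1+|z|^2\right)^2}\right|=0.$$ In particular, $$\lim_{n\to \infty} \frac{1}{\#\mathcal{P}_{n,r_n}}\sum_{P\in \mathcal{P}_{n,r_n}} \frac{1}{n}\sum_{\substack{z\in\mathbb{C}\\ P(z)=0}}f(z)=\frac{i}{2\pi}\int_\mathbb{C}f(z)\frac{dz\wedge d\overline{z}}{\left(1+|z|^2\right)^2}.$$ Zeros of polynomials are counted with multiplicity.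
   Context: For a polynomial $P=\sum_{k=0}^n a_kX^k=a_n\prod_{k=1}^{n}(X-\alpha_k)\in\mathbb{C}[X]$ with $a_n\neq 0$, $n\ge 1$, define $$h_{\mathrm{FS}}(P)=\tfrac{1}{n}\log|a_n|+\tfrac{1}{2n}\sum_{k=1}^n\log(1+|\alpha_k|^2), \qquad h_{B}(P)=\tfrac{1}{n}\log \max_{0\le k\le n}\frac{|a_k|}{\sqrt{\binom{n}{k}}}.$$ With $z=x+iy$ one has $\frac{i}{2\pi}dz\wedge d\overline{z}=\frac1\pi dx\,dy$. *)

theory Defs
  imports "HOL-Analysis.Analysis" "HOL-Computational_Algebra.Computational_Algebra"
begin

abbreviation complex_of_int_poly :: "int poly \<Rightarrow> complex poly" where
  "complex_of_int_poly \<equiv> map_poly of_int"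

text \<open>Both heights are meant for polynomials of degree at least 1. The multiset \<^term>\<open>proots P\<close>
  lists the roots with multiplicity; over the complex numbers it has exactly \<^term>\<open>degree P\<close>
  elements.\<close>

definition h_FS :: "complex poly \<Rightarrow> real" where
  "h_FS P = 1 / real (degree P) * ln (cmod (lead_coeff P))
     + 1 / (2 * real (degree P)) * (\<Sum>\<alpha>\<in>#proots P. ln (1 + (cmod \<alpha>)\<^sup>2))"

definition h_B :: "complex poly \<Rightarrow> real" where
  "h_B P = 1 / real (degree P) *
     ln (Max ((\<lambda>k. cmod (coeff P k) / sqrt (real (degree P choose k))) ` {0..degree P}))"

definition bounded_int_polys :: "nat \<Rightarrow> real \<Rightarrow> int poly set" where
  "bounded_int_polys n r = {P. degree P = n \<and> h_B (complex_of_int_poly P) \<le> r}"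

text \<open>The integral against the Fubini--Study form
  \<open>i/(2\<pi>) dz \<and> dz' / (1 + |z|\<^sup>2)\<^sup>2\<close> (\<open>z'\<close> the conjugate), using
  \<open>i/(2\<pi>) dz \<and> dz' = 1/\<pi> dx dy\<close>; \<^term>\<open>lborel\<close> on the complex plane is the area
  measure \<open>dx dy\<close>.\<close>

definition FS_integral :: "(complex \<Rightarrow> complex) \<Rightarrow> complex" where
  "FS_integral f = 1 / of_real pi * (LINT z|lborel. f z / of_real ((1 + (cmod z)\<^sup>2)\<^sup>2))"

text \<open>The set is finite, so averages over it make sense. (For \<^term>\<open>n = 0\<close> it is not,
  which is irrelevant to limits as \<open>n\<close> tends to infinity.)\<close>

lemma finite_bounded_int_polys:
  assumes "n \<ge> 1"
  shows "finite (bounded_int_polys n r)"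
proof -
  define M where "M = \<lceil>exp (real n * r) * 2 ^ n\<rceil>"
  have bd: "\<bar>coeff P k\<bar> \<le> M" if P: "P \<in> bounded_int_polys n r" and k: "k \<le> n" for P k
  proof -
    have dP: "degree P = n" and hP: "h_B (complex_of_int_poly P) \<le> r"
      using P by (auto simp: bounded_int_polys_def)
    define g where "g k = cmod (of_int (coeff P k)) / sqrt (real (n choose k))" for k
    have dC: "degree (complex_of_int_poly P) = n"
      using dP by (simp add: degree_map_poly)
    have cC: "coeff (complex_of_int_poly P) j = of_int (coeff P j)" for j
      by (simp add: coeff_map_poly)
    have h: "h_B (complex_of_int_poly P) = 1 / real n * ln (Max (g ` {0..n}))"
      by (simp add: h_B_def dC cC g_def)
    have "coeff P n \<noteq> 0" using dP assms by fastforce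
    then have "0 < g n" by (simp add: g_def)
    also have "g n \<le> Max (g ` {0..n})" by (intro Max_ge) auto
    finally have pos: "0 < Max (g ` {0..n})" .
    have "ln (Max (g ` {0..n})) \<le> real n * r"
      using hP assms by (simp add: h field_simps)
    then have mx: "Max (g ` {0..n}) \<le> exp (real n * r)"
      using pos by (metis exp_le_cancel_iff exp_ln)
    have "g k \<le> Max (g ` {0..n})" using k by (intro Max_ge) auto
    then have gk: "g k \<le> exp (real n * r)" using mx by linarith
    have b1: "1 \<le> real (n choose k)" using k by (simp add: Suc_le_eq)
    have "n choose k \<le> 2 ^ n" by (metis binomial_le_pow2)
    then have "real (n choose k) \<le> real (2 ^ n)" by (simp only: of_nat_le_iff)
    then have b2: "real (n choose k) \<le> 2 ^ n" by simp
    have "sqrt (real (n choose k)) \<le> real (n choose k)"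
      using b1 by (intro real_le_lsqrt self_le_power) auto
    then have s2: "sqrt (real (n choose k)) \<le> 2 ^ n" using b2 by linarith
    have "real_of_int \<bar>coeff P k\<bar> = g k * sqrt (real (n choose k))"
      using b1 k by (simp add: g_def)
    also have "\<dots> \<le> exp (real n * r) * 2 ^ n"
      using gk s2 b1 by (intro mult_mono) auto
    also have "\<dots> \<le> real_of_int M" by (simp add: M_def)
    finally show ?thesis by linarith
  qed
  have "bounded_int_polys n r \<subseteq> Poly ` {xs. set xs \<subseteq> {-M..M} \<and> length xs = Suc n}"
  proof
    fix P assume P: "P \<in> bounded_int_polys n r"
    then have dP: "degree P = n" by (auto simp: bounded_int_polys_def)
    have "length (coeffs P) = Suc n"
      using dP assms by (subst length_coeffs_degree) auto
    moreover have "set (coeffs P) \<subseteq> {-M..M}"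
    proof
      fix x assume "x \<in> set (coeffs P)"
      then have "\<exists>k\<le>n. x = coeff P k"
        using dP \<open>length (coeffs P) = Suc n\<close>
        by (metis in_set_conv_nth coeffs_nth less_Suc_eq_le length_0_conv coeffs_eq_Nil nat.distinct(1))
      then obtain k where "k \<le> n" "x = coeff P k" by blast
      then show "x \<in> {-M..M}" using bd[OF P, of k] by (simp add: abs_le_iff)
    qed
    ultimately show "P \<in> Poly ` {xs. set xs \<subseteq> {-M..M} \<and> length xs = Suc n}"
      by (metis (mono_tags, lifting) Poly_coeffs image_eqI mem_Collect_eq)
  qed
  then show ?thesis
    by (rule finite_subset) (intro finite_imageI finite_lists_length_eq, simp)
qed

end

theory Submission
  imports Defs "HOL-Real_Asymp.Real_Asymp"
begin

text \<open>
  Let \<open>\<mu>\<close> be the Fubini--Study probability measure and \<open>U\<^sub>s(P, w)\<close> (\<open>cap_height\<close>) the mean of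
  \<open>log \<bar>P(z)\<bar> / n - log (1 + \<bar>z\<bar>\<^sup>2) / 2\<close> over the circle on the Riemann sphere centred at
  \<open>w\<close> with radius parameter \<open>s\<close>, so \<open>s = 0\<close> gives the value at \<open>w\<close> itself. By rotation invariance
  \<open>\<integral> U\<^sub>s(P, w) d\<mu>(w) = h\<^sub>F\<^sub>S(P) - 1/2\<close> for every \<open>s\<close>. Cauchy--Schwarz gives the deterministic
  bound \<open>U\<^sub>0(P, w) \<le> r + log (n + 1) / (2n)\<close>. Conversely, comparing the circle with \<open>N\<close> equidistant
  points on it costs at most \<open>log 2 / N\<close>, because
  \<open>\<bar>a\<^sup>N - b\<^sup>N\<bar> \<le> 2 max (\<bar>a\<bar>, \<bar>b\<bar>)\<^sup>N\<close>, and at each fixed point most polynomials of height at most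
  \<open>r\<close> have a value of nearly maximal size; hence \<open>U\<^sub>s(P, w) \<ge> r - o(1)\<close> for most \<open>P\<close>, uniformly in
  \<open>w\<close>. Integrating over \<open>w\<close> yields (i). For (ii), the difference \<open>U\<^sub>s - U\<^sub>0\<close> is, up to a constant, the
  zero-counting measure smoothed by a nonnegative kernel supported in caps of radius \<open>s\<close>.
\<close>

section \<open>Planar area under a smooth change of variables\<close>

text \<open>The obstacle is that \<open>U_0\<close> has no lower bound near zeros. For
  \<open>s > 0\<close> there is the floor \<open>h_FS p + ln s - ln (1 + s^2)\<close>, and
  \<open>h_FS\<close> is nonnegative because the leading coefficient is a nonzero integer. An
  exceptional polynomial thus costs a bounded amount at every \<open>w\<close>, and it is enough
  that the exceptional share tends to 0. A value counts as small below \<open>\<delta>\<close> times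
  its typical size. The number \<open>N\<close> of sample points is fixed first, then
  \<open>\<delta> = 1 / n\<close>: the loss in height is of order \<open>ln n / n\<close>, and the
  exceptional share is at most \<open>N * (2 / n + exp (- (n * r)))\<close>. The last term is the
  effect of rounding, since every coefficient ranges over at least about \<open>exp (n * r)\<close>
  integers; this is where \<open>r_n\<close> must stay away from 0. No circle integrals occur:
  \<open>U_s\<close> is defined root by root through the closed form that Jensen's formula gives.
  Rotation invariance then amounts to one fact, that the squared chordal distance to any fixed point
  is uniformly distributed on \<open>[0, 1]\<close>. It is proved by rotating that point to 0 and
  using an equal-area projection to the disc.\<close>

definition complex_of_vec :: "real^2 \<Rightarrow> complex" where
  "complex_of_vec x = Complex (x $ 1) (x $ 2)"

definition vec_of_complex :: "complex \<Rightarrow> real^2" where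
  "vec_of_complex z = (\<chi> i. if i = 1 then Re z else Im z)"

lemma complex_of_vec_of_complex [simp]: "complex_of_vec (vec_of_complex z) = z"
  by (simp add: complex_of_vec_def vec_of_complex_def)

lemma vec_of_complex_of_vec [simp]: "vec_of_complex (complex_of_vec x) = x"
  by (simp add: complex_of_vec_def vec_of_complex_def vec_eq_iff forall_2)

lemma bounded_linear_complex_of_vec: "bounded_linear complex_of_vec"
  by (intro linear_linear[THEN iffD2] linearI)
     (simp_all add: complex_of_vec_def complex_eq_iff linear_conv_bounded_linear)

lemma bounded_linear_vec_of_complex: "bounded_linear vec_of_complex"
  by (intro linear_linear[THEN iffD2] linearI)
     (simp_all add: vec_of_complex_def vec_eq_iff forall_2 linear_conv_bounded_linear)

lemma complex_of_vec_measurable [measurable]: "complex_of_vec \<in> borel_measurable borel"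
  by (intro borel_measurable_continuous_onI linear_continuous_on bounded_linear_complex_of_vec)

text \<open>The coordinate map takes boxes to boxes with the same side lengths, and boxes determine
  the measure. The change of variables is done in \<open>real^2\<close>, where Jacobians are matrix
  determinants; this identity brings it back to the complex plane.\<close>

lemma lborel_complex_eq_distr: "(lborel :: complex measure) = distr lborel borel complex_of_vec"
proof (rule lborel_eqI)
  fix l u :: complex
  assume le: "\<And>b. b \<in> Basis \<Longrightarrow> l \<bullet> b \<le> u \<bullet> b"
  have "complex_of_vec -` box l u = box (vec_of_complex l) (vec_of_complex u)"
    by (auto simp: box_def Basis_complex_def complex_of_vec_def vec_of_complex_def
        Basis_vec_def inner_axis forall_2)
  then have "emeasure (distr lborel borel complex_of_vec) (box l u)
      = emeasure lborel (box (vec_of_complex l) (vec_of_complex u))"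
    by (simp add: emeasure_distr)
  also have "\<dots> = (\<Prod>b\<in>Basis. (u - l) \<bullet> b)"
    using le[of 1] le[of \<i>]
    by (subst emeasure_lborel_box)
       (auto simp: Basis_vec_def Basis_complex_def inner_axis vec_of_complex_def
         UNION_singleton_eq_range UNIV_2 axis_eq_axis complex_i_not_one)
  finally show "emeasure (distr lborel borel complex_of_vec) (box l u) = (\<Prod>b\<in>Basis. (u - l) \<bullet> b)" .
qed simp

text \<open>Only the area of the image is asked for, because the image will be a disc without
  finitely many points. \<open>J\<close> has to match the absolute determinant on \<open>S\<close>
  alone, but it is measurable everywhere, so that a global formula can be supplied for it.\<close>

lemma emeasure_lborel_complex_image:
  fixes G :: "complex \<Rightarrow> complex"
  assumes S: "S \<in> sets borel" and GS: "G ` S \<in> sets borel" and fin: "emeasure lborel (G ` S) < \<infinity>"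
    and der: "\<And>x. x \<in> S \<Longrightarrow> (G has_derivative G' x) (at x)"
    and inj: "inj_on G S"
    and J: "\<And>x. x \<in> S \<Longrightarrow> \<bar>Re (G' x 1) * Im (G' x \<i>) - Im (G' x 1) * Re (G' x \<i>)\<bar> = J x"
    and Jm [measurable]: "J \<in> borel_measurable borel"
  shows "(\<integral>\<^sup>+z. ennreal (J z) * indicator S z \<partial>lborel) = emeasure lborel (G ` S)"
proof -
  let ?V = "complex_of_vec -` S"
  let ?g = "\<lambda>x. vec_of_complex (G (complex_of_vec x))"
  let ?g' = "\<lambda>x h. vec_of_complex (G' (complex_of_vec x) (complex_of_vec h))"
  have V [measurable]: "?V \<in> sets borel"
    using measurable_sets[OF complex_of_vec_measurable S] by simp
  have im: "?g ` ?V = complex_of_vec -` (G ` S)"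
  proof (rule set_eqI, rule iffI)
    fix x assume "x \<in> ?g ` ?V"
    then show "x \<in> complex_of_vec -` (G ` S)" by auto
  next
    fix x assume "x \<in> complex_of_vec -` (G ` S)"
    then obtain y where y: "complex_of_vec x = G y" "y \<in> S" by auto
    then have "x = ?g (vec_of_complex y)"
      by (metis complex_of_vec_of_complex vec_of_complex_of_vec)
    then show "x \<in> ?g ` ?V" using y by (intro image_eqI[of _ _ "vec_of_complex y"]) auto
  qed
  have imb: "?g ` ?V \<in> sets borel"
    using measurable_sets[OF complex_of_vec_measurable GS] by (simp add: im)
  have em: "emeasure lborel (?g ` ?V) = emeasure lborel (G ` S)"
  proof -
    have "emeasure lborel (G ` S) = emeasure (distr lborel borel complex_of_vec) (G ` S)"
      by (rule arg_cong[OF lborel_complex_eq_distr])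
    also have "\<dots> = emeasure lborel (?g ` ?V)"
      unfolding im using GS by (simp add: emeasure_distr)
    finally show ?thesis by (rule sym)
  qed
  have derg: "(?g has_derivative ?g' x) (at x within ?V)" if "x \<in> ?V" for x
  proof -
    have 1: "(complex_of_vec has_derivative complex_of_vec) (at x within ?V)"
      by (simp add: bounded_linear_complex_of_vec bounded_linear_imp_has_derivative)
    have 2: "(G has_derivative G' (complex_of_vec x)) (at (complex_of_vec x))"
      using der that by simp
    have "((\<lambda>x. G (complex_of_vec x)) has_derivative (\<lambda>h. G' (complex_of_vec x) (complex_of_vec h))) (at x within ?V)"
      using has_derivative_compose[OF 1 2] .
    then show ?thesis
      by (rule bounded_linear.has_derivative[OF bounded_linear_vec_of_complex])
  qed
  have injg: "inj_on ?g ?V"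
  proof (rule inj_onI)
    fix x y assume "x \<in> ?V" "y \<in> ?V" and "?g x = ?g y"
    then have "complex_of_vec (?g x) = complex_of_vec (?g y)" by (simp only:)
    then have "G (complex_of_vec x) = G (complex_of_vec y)" by simp
    then have "complex_of_vec x = complex_of_vec y"
      using inj \<open>x \<in> ?V\<close> \<open>y \<in> ?V\<close> by (auto dest: inj_onD)
    then have "vec_of_complex (complex_of_vec x) = vec_of_complex (complex_of_vec y)" by (simp only:)
    then show "x = y" by simp
  qed
  have ax: "complex_of_vec (axis 1 1) = 1" "complex_of_vec (axis 2 1) = \<i>"
    by (simp_all add: complex_of_vec_def axis_def complex_eq_iff)
  have det: "\<bar>det (matrix (?g' x))\<bar> = J (complex_of_vec x)" if "x \<in> ?V" for x
  proof -
    have "det (matrix (?g' x)) = Re (G' (complex_of_vec x) 1) * Im (G' (complex_of_vec x) \<i>)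
       - Re (G' (complex_of_vec x) \<i>) * Im (G' (complex_of_vec x) 1)"
      by (simp add: det_2 matrix_def ax vec_of_complex_def)
    then show ?thesis using J[of "complex_of_vec x"] that by (simp add: mult.commute)
  qed
  have lm: "?g ` ?V \<in> lmeasurable"
    using imb em fin by (simp add: fmeasurable_def)
  \<comment> \<open>The rule is an equivalence between the measure of the image and the integral of
    the determinant; it is read from the image, the known side, to the integral.\<close>
  have "((\<lambda>x. \<bar>det (matrix (?g' x))\<bar>) has_integral measure lebesgue (?g ` ?V)) ?V"
  proof (rule has_measure_differentiable_image[THEN iffD1, OF _ derg injg conjI])
    show "?V \<in> sets lebesgue" using V by simp
  qed (use lm in simp_all)
  then have hi: "((\<lambda>x. J (complex_of_vec x)) has_integral measure lebesgue (?g ` ?V)) ?V"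
    by (rule has_integral_eq[rotated]) (rule det)
  have J0: "J z \<ge> 0" if "z \<in> S" for z using J[OF that] by linarith
  have hi': "((\<lambda>x. J (complex_of_vec x) * indicator ?V x) has_integral measure lebesgue (?g ` ?V)) UNIV"
  proof -
    have "((\<lambda>x. if x \<in> ?V then J (complex_of_vec x) else 0) has_integral measure lebesgue (?g ` ?V)) UNIV"
      using hi by (simp only: has_integral_restrict_UNIV)
    moreover have "(\<lambda>x. if x \<in> ?V then J (complex_of_vec x) else 0) = (\<lambda>x. J (complex_of_vec x) * indicator ?V x)"
      by (auto simp: fun_eq_iff indicator_def)
    ultimately show ?thesis by (simp only:)
  qed
  have "(\<integral>\<^sup>+z. ennreal (J z) * indicator S z \<partial>lborel)
      = (\<integral>\<^sup>+x. ennreal (J (complex_of_vec x) * indicator ?V x) \<partial>lborel)"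
    by (subst lborel_complex_eq_distr, subst nn_integral_distr)
       (use S in \<open>auto intro!: nn_integral_cong simp: indicator_def\<close>)
  also have "\<dots> = ennreal (measure lebesgue (?g ` ?V))"
  proof (rule nn_integral_has_integral_lborel[OF _ _ hi'])
    show "(\<lambda>x. J (complex_of_vec x) * indicator ?V x) \<in> borel_measurable borel" by measurable
    show "0 \<le> J (complex_of_vec x) * indicator ?V x" for x
      using J0 by (auto simp: indicator_def)
  qed
  also have "\<dots> = emeasure lebesgue (?g ` ?V)"
    by (rule emeasure_eq_measure2[OF lm, symmetric])
  also have "\<dots> = emeasure lborel (?g ` ?V)"
  proof -
    have "emeasure lebesgue X = emeasure lborel X" if "X \<in> sets borel" for X :: "(real^2) set"
      using that by simp
    then show ?thesis using imb .
  qed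
  finally show ?thesis unfolding em .
qed

section \<open>The Fubini--Study measure and spherical caps\<close>

definition fs_measure :: "complex measure" where
  "fs_measure = density lborel (\<lambda>z. ennreal (1 / (pi * (1 + (cmod z)\<^sup>2)\<^sup>2)))"

text \<open>Squared chordal distance on a Riemann sphere of diameter 1, so that antipodal points
  have value 1. The antipode of \<open>\<alpha>\<close> is
  \<open>- 1 / cnj \<alpha>\<close>.\<close>

definition chordal_sq :: "complex \<Rightarrow> complex \<Rightarrow> real" where
  "chordal_sq \<alpha> w = (cmod (w - \<alpha>))\<^sup>2 / ((1 + (cmod w)\<^sup>2) * (1 + (cmod \<alpha>)\<^sup>2))"

lemma one_plus_sq_pos [simp]: "0 < 1 + (cmod z)\<^sup>2" "1 + (cmod z)\<^sup>2 \<noteq> 0"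
  using zero_le_power2[of "cmod z"] by linarith+

text \<open>Lagrange's identity for the vectors \<open>(w, 1)\<close> and
  \<open>(\<alpha>, 1)\<close>. Geometrically it is Pythagoras: \<open>w\<close>,
  \<open>\<alpha>\<close> and the antipode of \<open>\<alpha>\<close> form a right-angled triangle
  whose hypotenuse is a diameter.\<close>

lemma cmod_diff_add_cmod_one_plus:
  "(cmod (w - \<alpha>))\<^sup>2 + (cmod (1 + cnj \<alpha> * w))\<^sup>2 = (1 + (cmod w)\<^sup>2) * (1 + (cmod \<alpha>)\<^sup>2)"
  unfolding cmod_power2 by (simp add: power2_eq_square algebra_simps)

lemma cmod_one_plus_cnj_commute: "cmod (1 + cnj \<alpha> * w) = cmod (1 + cnj w * \<alpha>)"
  by (metis complex_cnj_add complex_cnj_cnj complex_cnj_mult complex_cnj_one complex_mod_cnj mult.commute)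

lemma one_minus_chordal_sq:
  "1 - chordal_sq \<alpha> w = (cmod (1 + cnj \<alpha> * w))\<^sup>2 / ((1 + (cmod w)\<^sup>2) * (1 + (cmod \<alpha>)\<^sup>2))"
proof -
  define D where "D = (1 + (cmod w)\<^sup>2) * (1 + (cmod \<alpha>)\<^sup>2)"
  have "D \<noteq> 0" by (simp add: D_def)
  moreover have "(cmod (w - \<alpha>))\<^sup>2 + (cmod (1 + cnj \<alpha> * w))\<^sup>2 = D"
    unfolding D_def by (rule cmod_diff_add_cmod_one_plus)
  ultimately show ?thesis
    unfolding chordal_sq_def D_def[symmetric] by (simp add: diff_divide_eq_iff)
qed

lemma chordal_sq_nonneg: "0 \<le> chordal_sq \<alpha> w"
  by (simp add: chordal_sq_def)

lemma chordal_sq_le_1: "chordal_sq \<alpha> w \<le> 1"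
proof -
  have "0 \<le> 1 - chordal_sq \<alpha> w" unfolding one_minus_chordal_sq by simp
  then show ?thesis by simp
qed

lemma chordal_sq_eq_0_iff: "chordal_sq \<alpha> w = 0 \<longleftrightarrow> w = \<alpha>"
  using one_plus_sq_pos[of w] one_plus_sq_pos[of \<alpha>] by (auto simp: chordal_sq_def)

lemma chordal_sq_measurable [measurable]: "chordal_sq \<alpha> \<in> borel_measurable borel"
  unfolding chordal_sq_def by measurable

text \<open>Stereographic coordinates followed by Lambert's azimuthal equal-area projection: the
  plane becomes the open unit disc, and the squared modulus of the image is the squared chordal
  distance to 0.\<close>

definition lambert :: "complex \<Rightarrow> complex" where
  "lambert z = z / of_real (sqrt (1 + (cmod z)\<^sup>2))"

definition lambert_inv :: "complex \<Rightarrow> complex" where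
  "lambert_inv y = y / of_real (sqrt (1 - (cmod y)\<^sup>2))"

lemma cmod_lambert_sq: "(cmod (lambert z))\<^sup>2 = (cmod z)\<^sup>2 / (1 + (cmod z)\<^sup>2)"
  by (simp add: lambert_def norm_divide power_divide)

lemma lambert_inv_lambert [simp]: "lambert_inv (lambert z) = z"
proof -
  have "1 - (cmod (lambert z))\<^sup>2 = 1 / (1 + (cmod z)\<^sup>2)"
    unfolding cmod_lambert_sq using one_plus_sq_pos[of z] by (simp add: field_simps)
  then show ?thesis
    by (simp add: lambert_inv_def lambert_def real_sqrt_divide)
qed

lemma lambert_lambert_inv [simp]:
  assumes "cmod y < 1" shows "lambert (lambert_inv y) = y"
proof -
  have pos: "0 < 1 - (cmod y)\<^sup>2"
    using assms by (simp add: power_less_one_iff abs_square_less_1)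
  have "1 + (cmod (lambert_inv y))\<^sup>2 = 1 / (1 - (cmod y)\<^sup>2)"
    using pos by (simp add: lambert_inv_def norm_divide power_divide field_simps)
  then show ?thesis
    using pos by (simp add: lambert_inv_def lambert_def real_sqrt_divide)
qed

lemma has_derivative_lambert:
  defines "q \<equiv> \<lambda>z. sqrt (1 + (cmod z)\<^sup>2)"
  shows "(lambert has_derivative
     (\<lambda>h. h / of_real (q z) - of_real ((Re z * Re h + Im z * Im h) / (q z) ^ 3) * z)) (at z)"
proof -
  have q: "q z > 0" by (simp add: q_def)
  have 1: "((\<lambda>z. 1 + (Re z)\<^sup>2 + (Im z)\<^sup>2) has_derivative (\<lambda>h. 2 * (Re z * Re h + Im z * Im h))) (at z)"
    by (auto intro!: derivative_eq_intros simp: algebra_simps)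
  have pos: "1 + (Re z)\<^sup>2 + (Im z)\<^sup>2 > 0"
    using zero_le_power2[of "Re z"] zero_le_power2[of "Im z"] by linarith
  have qe: "q = (\<lambda>z. sqrt (1 + (Re z)\<^sup>2 + (Im z)\<^sup>2))"
    by (rule ext) (simp only: q_def cmod_power2 add.assoc)
  have 2: "(q has_derivative (\<lambda>h. (Re z * Re h + Im z * Im h) / q z)) (at z)"
  proof -
    have "((\<lambda>z. sqrt (1 + (Re z)\<^sup>2 + (Im z)\<^sup>2)) has_derivative
      (\<lambda>h. 2 * (Re z * Re h + Im z * Im h) * (inverse (sqrt (1 + (Re z)\<^sup>2 + (Im z)\<^sup>2)) / 2))) (at z)"
      by (rule DERIV_compose_FDERIV[where f = sqrt, OF DERIV_real_sqrt[OF pos] 1])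
    moreover have "2 * X * (inverse a / 2) = X / a" for a X :: real
      by (simp add: field_simps)
    ultimately show ?thesis
      unfolding qe by (simp only:)
  qed
  have 3: "((\<lambda>z. inverse (q z) *\<^sub>R z) has_derivative
     (\<lambda>h. inverse (q z) *\<^sub>R h + (- (inverse (q z) * ((Re z * Re h + Im z * Im h) / q z) * inverse (q z))) *\<^sub>R z)) (at z)"
    using q by (intro has_derivative_scaleR[OF Deriv.has_derivative_inverse[OF _ 2] has_derivative_ident]) simp
  have 4: "lambert = (\<lambda>z. inverse (q z) *\<^sub>R z)"
    by (rule ext) (simp add: lambert_def q_def scaleR_conv_of_real field_simps)
  have 5: "inverse (q z) *\<^sub>R h + (- (inverse (q z) * ((Re z * Re h + Im z * Im h) / q z) * inverse (q z))) *\<^sub>R z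
      = h / of_real (q z) - of_real ((Re z * Re h + Im z * Im h) / (q z) ^ 3) * z" for h
  proof -
    have "inverse (q z) * (X / q z) * inverse (q z) = X / (q z) ^ 3" for X
      by (simp add: power3_eq_cube field_simps)
    moreover have "inverse (q z) *\<^sub>R h = h / of_real (q z)"
      by (simp add: scaleR_conv_of_real field_simps)
    ultimately show ?thesis by (simp only: scaleR_conv_of_real of_real_minus diff_conv_add_uminus minus_mult_left)
  qed
  show ?thesis using 3 unfolding 4[symmetric] 5 .
qed

text \<open>\<open>c\<close> plays the complex derivative of an inner holomorphic map, so
  \<open>L c\<close> and \<open>L (c * \<i>)\<close> are the columns of the composite's Jacobian
  matrix. For \<open>c = 1\<close> the determinant is \<open>pi\<close> times the Fubini-Study
  density, which is the equal-area property.\<close>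

lemma lambert_jacobian:
  fixes z c :: complex
  defines "q \<equiv> sqrt (1 + (cmod z)\<^sup>2)"
  defines "L \<equiv> \<lambda>h. h / of_real q - of_real ((Re z * Re h + Im z * Im h) / q ^ 3) * z"
  shows "Re (L c) * Im (L (c * \<i>)) - Im (L c) * Re (L (c * \<i>)) = (cmod c)\<^sup>2 / (1 + (cmod z)\<^sup>2)\<^sup>2"
proof -
  have q: "q > 0" by (simp add: q_def)
  have q2: "q\<^sup>2 = 1 + (Re z)\<^sup>2 + (Im z)\<^sup>2" by (simp add: q_def cmod_power2)
  define x y a b where "x = Re z" and "y = Im z" and "a = Re c" and "b = Im c"
  have L1: "Re (L c) = (a * q\<^sup>2 - (x * a + y * b) * x) / q ^ 3" "Im (L c) = (b * q\<^sup>2 - (x * a + y * b) * y) / q ^ 3"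
     "Re (L (c * \<i>)) = (- b * q\<^sup>2 - (- x * b + y * a) * x) / q ^ 3" "Im (L (c * \<i>)) = (a * q\<^sup>2 - (- x * b + y * a) * y) / q ^ 3"
    using q by (simp_all add: L_def x_def y_def a_def b_def field_simps power3_eq_cube power2_eq_square)
  have "Re (L c) * Im (L (c * \<i>)) - Im (L c) * Re (L (c * \<i>))
     = ((a * q\<^sup>2 - (x * a + y * b) * x) * (a * q\<^sup>2 - (- x * b + y * a) * y)
       - (b * q\<^sup>2 - (x * a + y * b) * y) * (- b * q\<^sup>2 - (- x * b + y * a) * x)) / (q\<^sup>2) ^ 3"
  proof -
    have "A / q ^ 3 * (B / q ^ 3) - C / q ^ 3 * (D / q ^ 3) = (A * B - C * D) / (q\<^sup>2) ^ 3" for A B C D :: real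
      by (simp add: diff_divide_distrib power_mult[symmetric] power_add[symmetric])
    then show ?thesis unfolding L1 .
  qed
  also have "((a * q\<^sup>2 - (x * a + y * b) * x) * (a * q\<^sup>2 - (- x * b + y * a) * y)
       - (b * q\<^sup>2 - (x * a + y * b) * y) * (- b * q\<^sup>2 - (- x * b + y * a) * x)) = (a\<^sup>2 + b\<^sup>2) * q\<^sup>2"
    using q2 unfolding x_def[symmetric] y_def[symmetric] by algebra
  also have "(a\<^sup>2 + b\<^sup>2) * q\<^sup>2 / (q\<^sup>2) ^ 3 = (cmod c)\<^sup>2 / (q\<^sup>2)\<^sup>2"
  proof -
    have "a\<^sup>2 + b\<^sup>2 = (cmod c)\<^sup>2" by (simp add: cmod_power2 a_def b_def)
    moreover have "X * q\<^sup>2 / (q\<^sup>2) ^ 3 = X / (q\<^sup>2)\<^sup>2" for X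
      using q by (simp add: power3_eq_cube power2_eq_square)
    ultimately show ?thesis by simp
  qed
  also have "q\<^sup>2 = 1 + (cmod z)\<^sup>2" by (simp add: q2 cmod_power2)
  finally show ?thesis .
qed

text \<open>The rotation of the sphere that takes \<open>\<alpha>\<close> to 0 and the antipode of
  \<open>\<alpha>\<close> to infinity. At that antipode the division by zero returns 0, hence the
  side condition \<open>1 + cnj \<alpha> * w \<noteq> 0\<close> in the lemmas below.\<close>

definition moebius :: "complex \<Rightarrow> complex \<Rightarrow> complex" where
  "moebius \<alpha> w = (w - \<alpha>) / (1 + cnj \<alpha> * w)"

lemma one_plus_moebius:
  assumes "1 + cnj \<alpha> * w \<noteq> 0"
  shows "1 + (cmod (moebius \<alpha> w))\<^sup>2 = (1 + (cmod w)\<^sup>2) * (1 + (cmod \<alpha>)\<^sup>2) / (cmod (1 + cnj \<alpha> * w))\<^sup>2"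
  unfolding cmod_diff_add_cmod_one_plus[of w \<alpha>, symmetric] using assms
  by (simp add: moebius_def norm_divide power_divide add_divide_distrib)

lemma cmod_lambert_moebius:
  assumes "1 + cnj \<alpha> * w \<noteq> 0"
  shows "(cmod (lambert (moebius \<alpha> w)))\<^sup>2 = chordal_sq \<alpha> w"
  unfolding cmod_lambert_sq one_plus_moebius[OF assms] using assms
  by (simp add: chordal_sq_def moebius_def norm_divide power_divide)

lemma one_plus_cnj_mult_self: "1 + cnj \<alpha> * \<alpha> = of_real (1 + (cmod \<alpha>)\<^sup>2)"
  by (metis complex_norm_square mult.commute of_real_1 of_real_add)

lemma one_plus_cnj_mult_self_nz [simp]: "1 + cnj \<alpha> * \<alpha> \<noteq> 0"
  unfolding one_plus_cnj_mult_self of_real_eq_0_iff by simp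

lemma one_minus_cnj_moebius:
  assumes "1 + cnj \<alpha> * w \<noteq> 0"
  shows "1 - cnj \<alpha> * moebius \<alpha> w = (1 + cnj \<alpha> * \<alpha>) / (1 + cnj \<alpha> * w)"
  using assms by (simp add: moebius_def field_simps)

lemma moebius_inverse:
  assumes "1 + cnj \<alpha> * w \<noteq> 0"
  shows "moebius (- \<alpha>) (moebius \<alpha> w) = w"
proof -
  have "moebius \<alpha> w + \<alpha> = w * (1 + cnj \<alpha> * \<alpha>) / (1 + cnj \<alpha> * w)"
    using assms by (simp add: moebius_def field_simps)
  then show ?thesis
    using one_minus_cnj_moebius[OF assms] assms one_plus_cnj_mult_self_nz[of \<alpha>]
    by (simp add: moebius_def[of "-\<alpha>"])
qed

text \<open>Rotating the centre to 0 and projecting turns the cap into the disc of radius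
  \<open>sqrt v\<close>, of area \<open>pi * v\<close>; the Jacobian of the composite is the
  integrand.\<close>

lemma emeasure_fs_chordal_ball_aux:
  assumes v: "0 < v" "v \<le> 1"
  shows "(\<integral>\<^sup>+z. ennreal (1 / (1 + (cmod z)\<^sup>2)\<^sup>2) *
      indicator {w. 1 + cnj \<alpha> * w \<noteq> 0 \<and> chordal_sq \<alpha> w < v} z \<partial>lborel) = ennreal (pi * v)"
proof -
  let ?S = "{w. 1 + cnj \<alpha> * w \<noteq> 0 \<and> chordal_sq \<alpha> w < v}"
  let ?G = "\<lambda>w. lambert (moebius \<alpha> w)"
  \<comment> \<open>The image of the point at infinity, if the cap contains it: the one point of the
    disc without a preimage in the plane.\<close>
  let ?P = "{y \<in> ball 0 (sqrt v). 1 - cnj \<alpha> * lambert_inv y = 0}"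
  let ?H = "\<lambda>y. moebius (- \<alpha>) (lambert_inv y)"
  have S: "?S \<in> sets borel" by measurable
  have lt1: "cmod y < 1" if "y \<in> ball 0 (sqrt v)" for y
    using that v by (auto intro: less_le_trans real_sqrt_le_1_iff[THEN iffD2])
  have HG: "?H (?G w) = w" if "w \<in> ?S" for w
    using that by (simp add: moebius_inverse)
  have G: "?G w \<in> ball 0 (sqrt v) - ?P" if w: "w \<in> ?S" for w
  proof -
    have "cmod (?G w) < sqrt v"
      using w cmod_lambert_moebius[of \<alpha> w] by (simp add: real_less_rsqrt)
    moreover have "1 - cnj \<alpha> * lambert_inv (?G w) \<noteq> 0"
      using w by (simp add: one_minus_cnj_moebius)
    ultimately show ?thesis by simp
  qed
  have H: "?H y \<in> ?S \<and> ?G (?H y) = y" if y: "y \<in> ball 0 (sqrt v) - ?P" for y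
  proof -
    have nz: "1 + cnj (- \<alpha>) * lambert_inv y \<noteq> 0" using y by simp
    have GH: "?G (?H y) = y"
      using moebius_inverse[OF nz] lt1[of y] y by simp
    have nz2: "1 + cnj \<alpha> * ?H y \<noteq> 0"
      using one_minus_cnj_moebius[OF nz] nz one_plus_cnj_mult_self_nz[of "-\<alpha>"] by simp
    have "chordal_sq \<alpha> (?H y) = (cmod y)\<^sup>2"
      using cmod_lambert_moebius[OF nz2] GH by simp
    also have "\<dots> < v" using y v
      by (metis DiffD1 mem_ball_0 norm_ge_zero order_less_imp_le real_sqrt_pow2 power_strict_mono zero_less_numeral)
    finally show ?thesis using nz2 GH by simp
  qed
  have im: "?G ` ?S = ball 0 (sqrt v) - ?P"
  proof
    show "?G ` ?S \<subseteq> ball 0 (sqrt v) - ?P" using G by blast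
    show "ball 0 (sqrt v) - ?P \<subseteq> ?G ` ?S"
      using H by (metis (no_types, lifting) image_eqI subsetI)
  qed
  have inj: "inj_on ?G ?S" by (rule inj_on_inverseI[of _ ?H]) (rule HG)
  have "?P \<subseteq> {lambert (1 / cnj \<alpha>)}"
  proof
    fix y assume y: "y \<in> ?P"
    then have *: "cnj \<alpha> * lambert_inv y = 1" by simp
    then have "\<alpha> \<noteq> 0" by auto
    with * have "lambert_inv y = 1 / cnj \<alpha>" by (simp add: field_simps)
    then show "y \<in> {lambert (1 / cnj \<alpha>)}" using lt1[of y] y by (metis (no_types, lifting) lambert_lambert_inv mem_Collect_eq singletonI)
  qed
  then have "finite ?P" by (rule finite_subset) simp
  then have P: "?P \<in> null_sets lborel" by (rule finite_imp_null_set_lborel)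
  have emim: "emeasure lborel (?G ` ?S) = ennreal (pi * v)"
    unfolding im using P v
    by (subst emeasure_Diff_null_set) (simp_all add: emeasure_ball unit_ball_vol_2)
  let ?c = "\<lambda>w. (1 + cnj \<alpha> * \<alpha>) / (1 + cnj \<alpha> * w)\<^sup>2"
  let ?q = "\<lambda>w. sqrt (1 + (cmod (moebius \<alpha> w))\<^sup>2)"
  let ?L = "\<lambda>w h. h / of_real (?q w) - of_real ((Re (moebius \<alpha> w) * Re h + Im (moebius \<alpha> w) * Im h) / ?q w ^ 3) * moebius \<alpha> w"
  have der: "(?G has_derivative (\<lambda>h. ?L w (?c w * h))) (at w)" if w: "w \<in> ?S" for w
  proof -
    have "(moebius \<alpha> has_field_derivative ?c w) (at w)"
      unfolding moebius_def[abs_def] using w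
      by (auto intro!: derivative_eq_intros simp: field_simps power2_eq_square)
    then have "(moebius \<alpha> has_derivative (\<lambda>h. ?c w * h)) (at w)"
      unfolding has_field_derivative_def .
    from has_derivative_compose[OF this has_derivative_lambert] show ?thesis .
  qed
  have "(\<integral>\<^sup>+z. ennreal (1 / (1 + (cmod z)\<^sup>2)\<^sup>2) * indicator ?S z \<partial>lborel) = emeasure lborel (?G ` ?S)"
  proof (rule emeasure_lborel_complex_image[OF S _ _ der inj])
    show "?G ` ?S \<in> sets borel" unfolding im using P by (auto simp: null_sets_def)
    show "emeasure lborel (?G ` ?S) < \<infinity>" by (simp add: emim)
    fix w assume w: "w \<in> ?S"
    have "\<bar>Re (?L w (?c w * 1)) * Im (?L w (?c w * \<i>)) - Im (?L w (?c w * 1)) * Re (?L w (?c w * \<i>))\<bar>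
        = (cmod (?c w))\<^sup>2 / (1 + (cmod (moebius \<alpha> w))\<^sup>2)\<^sup>2"
      using lambert_jacobian[where z="moebius \<alpha> w" and c="?c w"] by simp
    also have "\<dots> = 1 / (1 + (cmod w)\<^sup>2)\<^sup>2"
    proof -
      have "(cmod (?c w))\<^sup>2 = (1 + (cmod \<alpha>)\<^sup>2)\<^sup>2 / ((cmod (1 + cnj \<alpha> * w))\<^sup>2)\<^sup>2"
        unfolding one_plus_cnj_mult_self
        by (simp only: norm_divide norm_power norm_of_real power_divide power2_abs)
      then show ?thesis
        using w one_plus_sq_pos[of \<alpha>] one_plus_sq_pos[of w] by (simp add: one_plus_moebius power_divide power_mult_distrib)
    qed
    finally show "\<bar>Re (?L w (?c w * 1)) * Im (?L w (?c w * \<i>)) - Im (?L w (?c w * 1)) * Re (?L w (?c w * \<i>))\<bar>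
        = 1 / (1 + (cmod w)\<^sup>2)\<^sup>2" .
  qed simp_all
  then show ?thesis by (simp add: emim)
qed

lemma sets_fs_measure [simp, measurable_cong]: "sets fs_measure = sets borel"
  by (simp add: fs_measure_def)

lemma space_fs_measure [simp]: "space fs_measure = UNIV"
  by (simp add: fs_measure_def)

lemma emeasure_fs_chordal_ball:
  assumes v: "0 < v" "v \<le> 1"
  shows "emeasure fs_measure {w. chordal_sq \<alpha> w < v} = ennreal v"
proof -
  let ?T = "{w. chordal_sq \<alpha> w < v}"
  let ?S = "{w. 1 + cnj \<alpha> * w \<noteq> 0 \<and> chordal_sq \<alpha> w < v}"
  have fin: "finite {w. 1 + cnj \<alpha> * w = 0}"
  proof (rule finite_subset)
    show "{w. 1 + cnj \<alpha> * w = 0} \<subseteq> {- 1 / cnj \<alpha>}"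
    proof
      fix w assume w: "w \<in> {w. 1 + cnj \<alpha> * w = 0}"
      then have "\<alpha> \<noteq> 0" by auto
      then show "w \<in> {- 1 / cnj \<alpha>}" using w by (simp add: field_simps add_eq_0_iff)
    qed
  qed simp
  have "emeasure fs_measure ?T = (\<integral>\<^sup>+z. ennreal (1 / (pi * (1 + (cmod z)\<^sup>2)\<^sup>2)) * indicator ?T z \<partial>lborel)"
    unfolding fs_measure_def by (rule emeasure_density) measurable
  also have "\<dots> = (\<integral>\<^sup>+z. ennreal (1 / pi) * (ennreal (1 / (1 + (cmod z)\<^sup>2)\<^sup>2) * indicator ?S z) \<partial>lborel)"
  proof (rule nn_integral_cong_AE)
    have "AE z in lborel. z \<notin> {w. 1 + cnj \<alpha> * w = 0}"
      using finite_imp_null_set_lborel[OF fin] by (rule AE_not_in)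
    then show "AE z in lborel. ennreal (1 / (pi * (1 + (cmod z)\<^sup>2)\<^sup>2)) * indicator ?T z =
       ennreal (1 / pi) * (ennreal (1 / (1 + (cmod z)\<^sup>2)\<^sup>2) * indicator ?S z)"
      by eventually_elim (auto simp: indicator_def ennreal_mult'[symmetric])
  qed
  also have "\<dots> = ennreal (1 / pi) * ennreal (pi * v)"
    by (subst nn_integral_cmult, measurable) (simp add: emeasure_fs_chordal_ball_aux[OF v])
  also have "\<dots> = ennreal v" using v by (simp add: ennreal_mult'[symmetric])
  finally show ?thesis .
qed

text \<open>The antipode of 0 is infinity, so the plane is itself a cap around 0, with
  \<open>v = 1\<close>.\<close>

lemma emeasure_fs_UNIV: "emeasure fs_measure UNIV = 1"
proof -
  have "chordal_sq 0 w < 1" for w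
  proof -
    have "0 < 1 - chordal_sq 0 w" unfolding one_minus_chordal_sq by (simp add: add_pos_nonneg)
    then show ?thesis by simp
  qed
  then have "emeasure fs_measure UNIV = emeasure fs_measure {w. chordal_sq 0 w < 1}" by simp
  also have "\<dots> = 1" using emeasure_fs_chordal_ball[of 1 0] by simp
  finally show ?thesis .
qed

lemma finite_measure_fs_measure: "finite_measure fs_measure"
  by (rule finite_measureI) (simp add: emeasure_fs_UNIV)

lemma measure_fs_UNIV: "measure fs_measure UNIV = 1"
  by (simp add: measure_def emeasure_fs_UNIV)

lemma has_bochner_integral_fs_const: "has_bochner_integral fs_measure (\<lambda>w. k) (k::real)"
  using finite_measure.integrable_const[OF finite_measure_fs_measure, of k]
  by (simp add: has_bochner_integral_iff measure_fs_UNIV)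

text \<open>Archimedes' hat-box theorem, with the chordal distance to an arbitrary point as height.\<close>

lemma distr_uminus_chordal_sq:
  "distr fs_measure borel (\<lambda>w. - chordal_sq \<alpha> w) = density lborel (indicator {-1..0})"
\<comment> \<open>The criterion compares measures on upper rays; the minus sign turns the strict
  sublevel sets of \<open>chordal_sq\<close>, which are the caps, into preimages of such
  rays.\<close>
proof (rule measure_eqI_lessThan)
  have em: "emeasure (distr fs_measure borel (\<lambda>w. - chordal_sq \<alpha> w)) {x <..}
      = emeasure fs_measure {w. chordal_sq \<alpha> w < - x}" for x
    by (subst emeasure_distr) (auto intro!: arg_cong[of _ _ "emeasure fs_measure"])
  show "emeasure (distr fs_measure borel (\<lambda>w. - chordal_sq \<alpha> w)) {x <..} < \<infinity>" for x
  proof -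
    have "emeasure fs_measure {w. chordal_sq \<alpha> w < - x} \<le> emeasure fs_measure UNIV"
      by (intro emeasure_mono) auto
    then show ?thesis unfolding em emeasure_fs_UNIV by (simp add: le_less_trans)
  qed
  show "emeasure (distr fs_measure borel (\<lambda>w. - chordal_sq \<alpha> w)) {x <..}
      = emeasure (density lborel (indicator {-1..0})) {x <..}" for x
  proof -
    have rhs: "emeasure (density lborel (indicator {-1..0})) {x <..} = emeasure lborel ({-1..0::real} \<inter> {x<..})"
      by (subst emeasure_density) (auto simp: indicator_inter_arith[symmetric])
    consider "x < -1" | "-1 \<le> x" "x < 0" | "0 \<le> x" by linarith
    then show ?thesis
    proof cases
      case 1
      have "{w. chordal_sq \<alpha> w < - x} = UNIV" using chordal_sq_le_1[of \<alpha>] 1 by (smt (verit) UNIV_eq_I mem_Collect_eq)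
      moreover have "{-1..0::real} \<inter> {x<..} = {-1..0}" using 1 by auto
      ultimately show ?thesis unfolding em rhs by (simp add: emeasure_fs_UNIV)
    next
      case 2
      have "{-1..0::real} \<inter> {x<..} = {x<..0}" using 2 by auto
      then show ?thesis unfolding em rhs using 2 by (simp add: emeasure_fs_chordal_ball)
    next
      case 3
      have "{w. chordal_sq \<alpha> w < - x} = {}" using chordal_sq_nonneg[of \<alpha>] 3 by (smt (verit) Collect_empty_eq)
      moreover have "{-1..0::real} \<inter> {x<..} = {}" using 3 by auto
      ultimately show ?thesis unfolding em rhs by simp
    qed
  qed
qed simp_all

text \<open>The integral \<open>I\<close> does not depend on \<open>\<alpha>\<close>. This is the
  form in which rotation invariance enters everything below.\<close>

lemma has_bochner_integral_chordal_sq: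
  fixes h :: "real \<Rightarrow> real"
  assumes [measurable]: "h \<in> borel_measurable borel"
    and h: "has_bochner_integral lborel (\<lambda>u. indicator {0..1} u * h u) I"
  shows "has_bochner_integral fs_measure (\<lambda>w. h (chordal_sq \<alpha> w)) I"
proof -
  have "has_bochner_integral lborel (\<lambda>u. indicator {0..1} (- u) * h (- u)) I"
    using lborel_has_bochner_integral_real_affine_iff[of "-1" "\<lambda>u. indicator {0..1} u * h u" I 0] h by simp
  then have "has_bochner_integral lborel (\<lambda>u. indicator {-1..0} u *\<^sub>R h (- u)) I"
    by (rule has_bochner_integral_cong[THEN iffD1, rotated -1]) (auto simp: indicator_def)
  then have "has_bochner_integral (density lborel (\<lambda>u. ennreal (indicator {-1..0} u))) (\<lambda>u. h (- u)) I"
    by (intro has_bochner_integral_density) auto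
  then have "has_bochner_integral (density lborel (indicator {-1..0})) (\<lambda>u. h (- u)) I"
    by (simp add: ennreal_indicator)
  then have "has_bochner_integral (distr fs_measure borel (\<lambda>w. - chordal_sq \<alpha> w)) (\<lambda>u. h (- u)) I"
    by (simp only: distr_uminus_chordal_sq)
  moreover have m: "(\<lambda>w. - chordal_sq \<alpha> w) \<in> fs_measure \<rightarrow>\<^sub>M borel" "(\<lambda>u. h (- u)) \<in> borel_measurable borel"
    by measurable
  ultimately show ?thesis
    unfolding has_bochner_integral_iff integrable_distr_eq[OF m] integral_distr[OF m] by simp
qed

text \<open>By Jensen's formula this is the mean of the logarithm of the chordal distance to a fixed point over
  the circle with radius parameter \<open>s\<close> whose centre is at squared chordal distance \<open>u\<close> from it.\<close>

definition cap_log :: "real \<Rightarrow> real \<Rightarrow> real" where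
  "cap_log s u = (ln (max u (s\<^sup>2 * (1 - u))) - ln (1 + s\<^sup>2)) / 2"

lemma cap_log_measurable [measurable]: "cap_log s \<in> borel_measurable borel"
  unfolding cap_log_def by measurable

lemma cap_log_nonpos:
  assumes "0 \<le> u" "u \<le> 1" shows "cap_log s u \<le> 0"
proof -
  have "max u (s\<^sup>2 * (1 - u)) \<le> 1 + s\<^sup>2"
    using assms mult_left_mono[of "1 - u" 1 "s\<^sup>2"] zero_le_power2[of s] by linarith
  moreover have "0 \<le> max u (s\<^sup>2 * (1 - u))" using assms by simp
  moreover have "0 < 1 + s\<^sup>2" using zero_le_power2[of s] by linarith
  \<comment> \<open>The maximum vanishes only for \<open>s = 0\<close> and \<open>u = 0\<close>,
    where the default \<open>ln 0 = 0\<close> keeps the bound true.\<close>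
  ultimately have "ln (max u (s\<^sup>2 * (1 - u))) \<le> ln (1 + s\<^sup>2)"
    by (cases "max u (s\<^sup>2 * (1 - u)) = 0") auto
  then show ?thesis by (simp add: cap_log_def)
qed

section \<open>The mean of \<open>cap_log\<close> over the unit interval\<close>

lemma continuous_on_x_ln_x: "continuous_on {0..} (\<lambda>x::real. x * ln x)"
proof (rule continuous_on_eq_continuous_within[THEN iffD2], rule ballI)
  fix x :: real assume "x \<in> {0..}"
  then consider "x = 0" | "x > 0" by force
  then show "continuous (at x within {0..}) (\<lambda>x. x * ln x)"
  proof cases
    case 1
    have "((\<lambda>x::real. x * ln x) \<longlongrightarrow> 0) (at_right 0)" by real_asymp
    then have "((\<lambda>x::real. x * ln x) \<longlongrightarrow> 0) (at 0 within {0..})"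
      by (simp add: at_within_Ici_at_right)
    then show ?thesis using 1 by (simp add: continuous_within)
  next
    case 2
    then show ?thesis by (intro continuous_intros) auto
  qed
qed

text \<open>The branches of the maximum cross at \<open>v\<close>, and each has an elementary
  primitive. The dependence on \<open>\<sigma> = s^2\<close> is exactly the
  \<open>ln (1 + s^2)\<close> that \<open>cap_log\<close> subtracts, so the mean of
  \<open>cap_log s\<close> is the same for all \<open>s\<close>.\<close>

lemma has_integral_ln_max:
  fixes \<sigma> :: real
  assumes \<sigma>: "0 \<le> \<sigma>"
  shows "((\<lambda>u. ln (max u (\<sigma> * (1 - u)))) has_integral (ln (1 + \<sigma>) - 1)) {0..1}"
proof -
  define v where "v = \<sigma> / (1 + \<sigma>)"
  define F where "F = (\<lambda>u::real. u * ln u - u)"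
  define G where "G = (\<lambda>u::real. u * ln \<sigma> - (1 - u) * ln (1 - u) - u)"
  let ?f = "\<lambda>u. ln (max u (\<sigma> * (1 - u)))"
  have v: "0 \<le> v" "v < 1" "1 - v = 1 / (1 + \<sigma>)" using \<sigma> by (simp_all add: v_def field_simps)
  have ge: "\<sigma> * (1 - u) \<le> u \<longleftrightarrow> v \<le> u" for u
    using \<sigma> by (simp add: v_def field_simps)
  have le: "u \<le> \<sigma> * (1 - u) \<longleftrightarrow> u \<le> v" for u
    using \<sigma> by (simp add: v_def field_simps)
  have h1: "(?f has_integral (F 1 - F v)) {v..1}"
  proof (rule has_integral_eq)
    show "(ln has_integral (F 1 - F v)) {v..1}"
    \<comment> \<open>For \<open>\<sigma> = 0\<close> the left endpoint is 0, where \<open>F\<close>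
      is continuous but not differentiable.\<close>
    proof (rule fundamental_theorem_of_calculus_interior)
      show "v \<le> 1" using v by simp
      show "continuous_on {v..1} F" unfolding F_def
        using v by (intro continuous_intros continuous_on_subset[OF continuous_on_x_ln_x]) auto
      show "(F has_vector_derivative ln u) (at u)" if "u \<in> {v<..<1}" for u
        unfolding F_def has_real_derivative_iff_has_vector_derivative[symmetric]
        using that v by (auto intro!: derivative_eq_intros)
    qed
    show "ln u = ?f u" if "u \<in> {v..1}" for u
      using that ge[of u] by (simp add: max_def)
  qed
  have h2: "(?f has_integral (G v - G 0)) {0..v}"
  proof (cases "\<sigma> = 0")
    case True
    then show ?thesis using has_integral_refl(2)[of ?f 0] by (simp add: v_def)
  next
    case False
    then have pos: "\<sigma> > 0" using \<sigma> by simp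
    show ?thesis
    proof (rule has_integral_eq)
      show "((\<lambda>u. ln \<sigma> + ln (1 - u)) has_integral (G v - G 0)) {0..v}"
      proof (rule fundamental_theorem_of_calculus)
        show "0 \<le> v" by (rule v)
        show "(G has_vector_derivative ln \<sigma> + ln (1 - u)) (at u within {0..v})" if "u \<in> {0..v}" for u
          unfolding has_real_derivative_iff_has_vector_derivative[symmetric]
        proof -
          have "0 < 1 - u" using that v by simp
          then show "(G has_field_derivative ln \<sigma> + ln (1 - u)) (at u within {0..v})"
            unfolding G_def by (auto intro!: derivative_eq_intros)
        qed
      qed
      show "ln \<sigma> + ln (1 - u) = ?f u" if "u \<in> {0..v}" for u
      proof -
        have "max u (\<sigma> * (1 - u)) = \<sigma> * (1 - u)"
          using that le[of u] by (simp add: max_def)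
        then show ?thesis using that v pos by (simp add: ln_mult)
      qed
    qed
  qed
  have "(?f has_integral (G v - G 0 + (F 1 - F v))) {0..1}"
    using has_integral_combine[OF _ _ h2 h1] v by simp
  also have "G v - G 0 + (F 1 - F v) = ln (1 + \<sigma>) - 1"
  proof (cases "\<sigma> = 0")
    case True
    then show ?thesis by (simp add: v_def G_def F_def)
  next
    case False
    then have l: "ln \<sigma> = ln v + ln (1 + \<sigma>)" "ln (1 - v) = - ln (1 + \<sigma>)"
      using \<sigma> unfolding v(3) by (simp_all add: v_def ln_div)
    show ?thesis unfolding G_def F_def l by (simp add: algebra_simps)
  qed
  finally show ?thesis .
qed

text \<open>\<open>cap_log\<close> has constant sign on the unit interval, which turns the gauge
  integral into a Lebesgue integral even with the logarithmic singularity at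
  \<open>s = 0\<close>.\<close>

lemma has_bochner_integral_cap_log_unit:
  "has_bochner_integral lborel (\<lambda>u. indicator {0..1} u * cap_log s u) (- 1 / 2)"
proof -
  let ?g = "\<lambda>u. - (indicator {0..1} u * cap_log s u)"
  have "((\<lambda>u. (ln (1 + s\<^sup>2) - ln (max u (s\<^sup>2 * (1 - u)))) / 2) has_integral
      ((ln (1 + s\<^sup>2) * (1 - 0) - (ln (1 + s\<^sup>2) - 1)) / 2)) {0..1}"
    using has_integral_const_real[of "ln (1 + s\<^sup>2)" 0 1]
    by (intro has_integral_divide has_integral_diff has_integral_ln_max) simp_all
  then have "((\<lambda>u. (ln (1 + s\<^sup>2) - ln (max u (s\<^sup>2 * (1 - u)))) / 2) has_integral (1 / 2)) {0..1}"
    by simp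
  then have "((\<lambda>u. if u \<in> {0..1} then (ln (1 + s\<^sup>2) - ln (max u (s\<^sup>2 * (1 - u)))) / 2 else 0) has_integral (1 / 2)) UNIV"
    by (simp only: has_integral_restrict_UNIV)
  moreover have "(\<lambda>u. if u \<in> {0..1} then (ln (1 + s\<^sup>2) - ln (max u (s\<^sup>2 * (1 - u)))) / 2 else 0) = ?g"
    by (auto simp: fun_eq_iff cap_log_def indicator_def field_simps)
  ultimately have hi: "(?g has_integral (1 / 2)) UNIV" by simp
  have nn: "0 \<le> ?g u" for u
    using cap_log_nonpos[of u s] by (auto simp: indicator_def)
  have m: "?g \<in> borel_measurable borel" by measurable
  have "has_bochner_integral lborel ?g (1 / 2)"
    using nn_integral_has_integral_lborel[OF m nn hi] nn m
    by (intro has_bochner_integral_nn_integral) auto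
  from has_bochner_integral_minus[OF this] show ?thesis by simp
qed

lemma has_bochner_integral_cap_log:
  "has_bochner_integral fs_measure (\<lambda>w. cap_log s (chordal_sq \<alpha> w)) (- 1 / 2)"
  by (intro has_bochner_integral_chordal_sq has_bochner_integral_cap_log_unit) measurable

section \<open>Averages of the logarithm of a polynomial over circles on the sphere\<close>

text \<open>Evaluation in homogeneous coordinates, since a sample point on a circle of the sphere
  may be infinity, where \<open>y = 0\<close>.\<close>

definition hom_eval :: "complex poly \<Rightarrow> complex \<Rightarrow> complex \<Rightarrow> complex" where
  "hom_eval p x y = (\<Sum>k\<le>degree p. coeff p k * x ^ k * y ^ (degree p - k))"

lemma hom_eval_eq_poly:
  assumes "y \<noteq> 0" shows "hom_eval p x y = y ^ degree p * poly p (x / y)"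
  unfolding hom_eval_def poly_altdef sum_distrib_left
proof (rule sum.cong)
  fix k assume k: "k \<in> {..degree p}"
  then have "y ^ degree p = y ^ k * y ^ (degree p - k)"
    by (simp add: power_add[symmetric])
  then show "coeff p k * x ^ k * y ^ (degree p - k) = y ^ degree p * (coeff p k * (x / y) ^ k)"
    using assms by (simp add: power_divide)
qed simp

lemma hom_eval_0: "hom_eval p x 0 = lead_coeff p * x ^ degree p"
proof -
  have "hom_eval p x 0 = (\<Sum>k\<le>degree p. if k = degree p then lead_coeff p * x ^ degree p else 0)"
    unfolding hom_eval_def by (intro sum.cong) auto
  then show ?thesis by simp
qed

text \<open>Jensen's closed form, summed over the roots, takes the place of a mean over a circle.
  For \<open>s = 0\<close> a root equal to \<open>w\<close> contributes the default
  \<open>ln 0 = 0\<close> and not minus infinity, so pointwise statements about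
  \<open>cap_height 0\<close> exclude the roots.\<close>

definition cap_height :: "real \<Rightarrow> complex poly \<Rightarrow> complex \<Rightarrow> real" where
  "cap_height s p w = h_FS p + (\<Sum>\<alpha>\<in>#proots p. cap_log s (chordal_sq \<alpha> w)) / degree p"

text \<open>Enumerating the roots by indices turns multiset sums into sums and products over
  \<open>{..<n}\<close>; inside the locale \<open>n\<close> is the degree of
  \<open>p\<close>.\<close>

locale split_poly =
  fixes p :: "complex poly" and \<alpha> :: "nat \<Rightarrow> complex"
  assumes p_eq: "p = smult (lead_coeff p) (\<Prod>i<degree p. [:- \<alpha> i, 1:])"
    and degree_pos: "0 < degree p"
begin

abbreviation n :: nat where "n \<equiv> degree p"

lemma nz: "p \<noteq> 0" "lead_coeff p \<noteq> 0" using degree_pos by auto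

lemma proots_eq: "proots p = image_mset \<alpha> (mset_set {..<n})"
proof -
  have "proots p = proots (\<Prod>i<n. [:- \<alpha> i, 1:])"
    using nz by (subst p_eq) simp
  also have "\<dots> = (\<Sum>i<n. {#\<alpha> i#})"
    by (subst proots_prod) auto
  also have "\<dots> = image_mset \<alpha> (mset_set {..<n})"
  proof -
    have "(\<Sum>i<m. {#\<alpha> i#}) = image_mset \<alpha> (mset_set {..<m})" for m
      by (induction m) (simp_all add: lessThan_Suc)
    then show ?thesis .
  qed
  finally show ?thesis .
qed

lemma sum_proots: "(\<Sum>z\<in>#proots p. f z) = (\<Sum>i<n. f (\<alpha> i))"
  by (simp add: proots_eq sum_unfold_sum_mset image_mset.compositionality comp_def)

lemma poly_eq: "poly p x = lead_coeff p * (\<Prod>i<n. x - \<alpha> i)"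
  by (subst p_eq) (simp add: poly_prod)

lemma hom_eval_eq: "hom_eval p x y = lead_coeff p * (\<Prod>i<n. x - \<alpha> i * y)"
proof (cases "y = 0")
  case True
  then show ?thesis by (simp add: hom_eval_0)
next
  case False
  have "y ^ n * (\<Prod>i<n. x / y - \<alpha> i) = (\<Prod>i<n. y * (x / y - \<alpha> i))"
    by (simp add: prod.distrib)
  also have "\<dots> = (\<Prod>i<n. x - \<alpha> i * y)"
    using False by (intro prod.cong) (auto simp: field_simps)
  finally show ?thesis using False by (simp add: hom_eval_eq_poly poly_eq)
qed

lemma h_FS_eq: "n * h_FS p = ln (cmod (lead_coeff p)) + (\<Sum>i<n. ln (1 + (cmod (\<alpha> i))\<^sup>2)) / 2"
  using degree_pos by (simp add: h_FS_def sum_proots field_simps)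

lemma cap_height_eq: "n * cap_height s p w = n * h_FS p + (\<Sum>i<n. cap_log s (chordal_sq (\<alpha> i) w))"
  using degree_pos by (simp add: cap_height_def sum_proots field_simps)

lemma cap_height_0:
  assumes "poly p w \<noteq> 0"
  shows "n * cap_height 0 p w = ln (cmod (poly p w)) - n / 2 * ln (1 + (cmod w)\<^sup>2)"
proof -
  have ne: "w \<noteq> \<alpha> i" if "i < n" for i
    using assms that by (auto simp: poly_eq)
  have "cap_log 0 (chordal_sq (\<alpha> i) w)
      = ln (cmod (w - \<alpha> i)) - ln (1 + (cmod w)\<^sup>2) / 2 - ln (1 + (cmod (\<alpha> i))\<^sup>2) / 2" if "i < n" for i
    using ne[OF that]
    by (simp add: cap_log_def max_absorb1 chordal_sq_nonneg)
       (simp add: chordal_sq_def ln_div ln_mult ln_realpow diff_divide_distrib add_divide_distrib)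
  then have "n * cap_height 0 p w = ln (cmod (lead_coeff p)) + (\<Sum>i<n. ln (cmod (w - \<alpha> i)))
      - n / 2 * ln (1 + (cmod w)\<^sup>2)"
    unfolding cap_height_eq h_FS_eq by (simp add: sum_subtractf sum_divide_distrib)
  also have "(\<Sum>i<n. ln (cmod (w - \<alpha> i))) = ln (cmod (\<Prod>i<n. w - \<alpha> i))"
    unfolding prod_norm[symmetric] by (rule ln_prod[symmetric]) (use ne in auto)
  also have "ln (cmod (lead_coeff p)) + ln (cmod (\<Prod>i<n. w - \<alpha> i)) = ln (cmod (poly p w))"
    using assms by (simp add: poly_eq norm_mult ln_mult)
  finally show ?thesis .
qed

end

lemma split_poly_exists:
  assumes "0 < degree p"
  obtains \<alpha> where "split_poly p \<alpha>"
  using complex_poly_decompose'[of p] assms unfolding split_poly_def by metis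

lemma prod_roots_unity:
  fixes x y :: complex
  assumes "1 \<le> N"
  shows "(\<Prod>\<zeta> | \<zeta> ^ N = 1. x - \<zeta> * y) = x ^ N - y ^ N"
proof -
  let ?R = "{\<zeta>::complex. \<zeta> ^ N = 1}"
  have fin: "finite ?R" and card: "card ?R = N"
    using assms card_complex_roots_unity[of N] by (auto intro: card_ge_0_finite)
  have "(\<Prod>\<zeta>\<in>?R. [:- \<zeta>, 1:]) = monom 1 N - 1"
  \<comment> \<open>Agreement at the \<open>N\<close> roots of unity leaves one degree of freedom
    for degree at most \<open>N\<close>; the coefficient of degree \<open>N\<close> fixes
    it.\<close>
  proof (rule poly_eqI_degree_lead_coeff[where n = N and A = ?R])
    have d: "degree (\<Prod>\<zeta>\<in>?R. [:- \<zeta>, 1:]) = N"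
      by (subst degree_prod_sum_eq) (auto simp: card)
    moreover have "lead_coeff (\<Prod>\<zeta>\<in>?R. [:- \<zeta>, 1:]) = 1"
      by (simp add: lead_coeff_prod)
    ultimately show "coeff (\<Prod>\<zeta>\<in>?R. [:- \<zeta>, 1:]) N = coeff (monom 1 N - 1) N"
      using assms by (simp add: coeff_1)
    show "degree (\<Prod>\<zeta>\<in>?R. [:- \<zeta>, 1:]) \<le> N" using d by simp
    show "degree (monom (1::complex) N - 1) \<le> N"
      by (intro degree_diff_le degree_monom_le) simp
    show "poly (\<Prod>\<zeta>\<in>?R. [:- \<zeta>, 1:]) z = poly (monom 1 N - 1) z" if "z \<in> ?R" for z
      using that fin by (auto simp: poly_prod poly_monom intro!: bexI[of _ z])
  qed (simp add: card)
  then have *: "(\<Prod>\<zeta>\<in>?R. z - \<zeta>) = z ^ N - 1" for z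
    by (metis (no_types, lifting) poly_1 poly_diff poly_monom poly_prod add_uminus_conv_diff mult.left_neutral
        mult.right_neutral poly_pCons poly_0 mult_zero_right add.right_neutral add.commute prod.cong)
  show ?thesis
  proof (cases "y = 0")
    case True
    then show ?thesis using assms by (simp add: card)
  next
    case False
    have "x ^ N - y ^ N = y ^ N * ((x / y) ^ N - 1)"
      using False by (simp add: power_divide field_simps)
    also have "\<dots> = (\<Prod>\<zeta>\<in>?R. y * (x / y - \<zeta>))"
      by (simp add: *[symmetric] prod.distrib card)
    also have "\<dots> = (\<Prod>\<zeta>\<in>?R. x - \<zeta> * y)"
      using False by (intro prod.cong) (auto simp: field_simps)
    finally show ?thesis by simp
  qed
qed

text \<open>Up to a common factor the two moduli are the chordal distance from \<open>w\<close> to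
  \<open>\<alpha>\<close> and \<open>s\<close> times that to the antipode of
  \<open>\<alpha>\<close>. Their maximum is what the \<open>N\<close>-th powers in the sampling
  argument see.\<close>

lemma ln_max_cap_log:
  fixes \<alpha> w :: complex
  assumes s: "0 < s"
  defines "M \<equiv> max (cmod (w - \<alpha>)) (s * cmod (1 + cnj w * \<alpha>))"
  shows "0 < M" "ln M = cap_log s (chordal_sq \<alpha> w) + (ln (1 + s\<^sup>2) + ln (1 + (cmod w)\<^sup>2) + ln (1 + (cmod \<alpha>)\<^sup>2)) / 2"
proof -
  let ?D = "(1 + (cmod w)\<^sup>2) * (1 + (cmod \<alpha>)\<^sup>2)"
  let ?m = "max (chordal_sq \<alpha> w) (s\<^sup>2 * (1 - chordal_sq \<alpha> w))"
  have D: "0 < ?D" by simp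
  have M0: "0 \<le> M" by (simp add: M_def le_max_iff_disj)
  have m: "0 < ?m"
  proof (cases "chordal_sq \<alpha> w = 0")
    case False
    then show ?thesis using chordal_sq_nonneg[of \<alpha> w] by (auto simp: less_max_iff_disj)
  qed (use s in simp)
  have "M\<^sup>2 = max ((cmod (w - \<alpha>))\<^sup>2) ((s * cmod (1 + cnj \<alpha> * w))\<^sup>2)"
    unfolding M_def cmod_one_plus_cnj_commute[of w] using s by (simp add: max_def power_mono abs_le_square_iff[symmetric])
  also have "(cmod (w - \<alpha>))\<^sup>2 = ?D * chordal_sq \<alpha> w" by (simp add: chordal_sq_def)
  also have "(s * cmod (1 + cnj \<alpha> * w))\<^sup>2 = ?D * (s\<^sup>2 * (1 - chordal_sq \<alpha> w))"
    using D by (simp add: one_minus_chordal_sq power_mult_distrib)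
  also have "max (?D * chordal_sq \<alpha> w) (?D * (s\<^sup>2 * (1 - chordal_sq \<alpha> w))) = ?D * ?m"
    using D by (simp add: max_mult_distrib_left)
  finally have M2: "M\<^sup>2 = ?D * ?m" .
  then have "0 < M\<^sup>2" using m D by simp
  then show M: "0 < M" using M0 by (metis less_eq_real_def power_zero_numeral order_less_irrefl)
  have "2 * ln M = ln (M\<^sup>2)" using M by (simp add: ln_realpow)
  also have "\<dots> = ln (1 + (cmod w)\<^sup>2) + ln (1 + (cmod \<alpha>)\<^sup>2) + ln ?m"
    unfolding M2 using m by (simp add: ln_mult)
  finally show "ln M = cap_log s (chordal_sq \<alpha> w) + (ln (1 + s\<^sup>2) + ln (1 + (cmod w)\<^sup>2) + ln (1 + (cmod \<alpha>)\<^sup>2)) / 2"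
    by (simp add: cap_log_def field_simps)
qed

text \<open>The points \<open>[w + s * \<zeta> : 1 - cnj w * s * \<zeta>]\<close> are the images of
  \<open>s * \<zeta>\<close> under the rotation that takes 0 to \<open>w\<close>. The factor of a
  root is linear in \<open>\<zeta>\<close>, so its product over all \<open>\<zeta>\<close> is a
  difference of two \<open>N\<close>-th powers; each root costs at most \<open>ln 2\<close>.\<close>

lemma (in split_poly) sum_ln_hom_eval_le:
  assumes N: "1 \<le> N" and s: "0 < s"
    and nz': "\<And>\<zeta>::complex. \<zeta> ^ N = 1 \<Longrightarrow> hom_eval p (w + s * \<zeta>) (1 - cnj w * (s * \<zeta>)) \<noteq> 0"
  shows "(\<Sum>\<zeta>::complex | \<zeta> ^ N = 1. ln (cmod (hom_eval p (w + s * \<zeta>) (1 - cnj w * (s * \<zeta>)))))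
     \<le> n * (N * cap_height s p w + N / 2 * ln ((1 + s\<^sup>2) * (1 + (cmod w)\<^sup>2)) + ln 2)"
proof -
  let ?R = "{\<zeta>::complex. \<zeta> ^ N = 1}"
  let ?x = "\<lambda>\<zeta>::complex. w + s * \<zeta>" and ?y = "\<lambda>\<zeta>::complex. 1 - cnj w * (s * \<zeta>)"
  define M where "M \<beta> = max (cmod (w - \<beta>)) (s * cmod (1 + cnj w * \<beta>))" for \<beta>
  have fin: "finite ?R" and card: "card ?R = N"
    using N card_complex_roots_unity[of N] by (auto intro: card_ge_0_finite)
  have 1: "cmod (\<Prod>\<zeta>\<in>?R. ?x \<zeta> - \<beta> * ?y \<zeta>) \<le> 2 * M \<beta> ^ N" for \<beta>
  proof -
    have "(\<Prod>\<zeta>\<in>?R. ?x \<zeta> - \<beta> * ?y \<zeta>) = (\<Prod>\<zeta>\<in>?R. (w - \<beta>) - \<zeta> * (- s * (1 + cnj w * \<beta>)))"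
      by (intro prod.cong) (auto simp: algebra_simps)
    also have "\<dots> = (w - \<beta>) ^ N - (- s * (1 + cnj w * \<beta>)) ^ N"
      by (rule prod_roots_unity[OF N])
    finally have "cmod (\<Prod>\<zeta>\<in>?R. ?x \<zeta> - \<beta> * ?y \<zeta>) \<le> cmod (w - \<beta>) ^ N + (s * cmod (1 + cnj w * \<beta>)) ^ N"
      using s norm_triangle_ineq4[of "(w - \<beta>) ^ N" "(- s * (1 + cnj w * \<beta>)) ^ N"]
      by (simp add: norm_power norm_mult)
    also have "\<dots> \<le> M \<beta> ^ N + M \<beta> ^ N"
      using s by (intro add_mono power_mono) (auto simp: M_def)
    finally show ?thesis by simp
  qed
  have nzf: "?x \<zeta> - \<alpha> i * ?y \<zeta> \<noteq> 0" if "\<zeta> \<in> ?R" "i < n" for \<zeta> i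
    using nz'[of \<zeta>] that by (auto simp: hom_eval_eq)
  have 2: "(\<Sum>\<zeta>\<in>?R. ln (cmod (?x \<zeta> - \<alpha> i * ?y \<zeta>))) \<le> ln 2 + N * ln (M (\<alpha> i))" if i: "i < n" for i
  proof -
    have "(\<Sum>\<zeta>\<in>?R. ln (cmod (?x \<zeta> - \<alpha> i * ?y \<zeta>))) = ln (cmod (\<Prod>\<zeta>\<in>?R. ?x \<zeta> - \<alpha> i * ?y \<zeta>))"
      unfolding prod_norm[symmetric] by (subst ln_prod) (use nzf i fin in auto)
    also have "\<dots> \<le> ln (2 * M (\<alpha> i) ^ N)"
      using 1[of "\<alpha> i"] nzf i fin by (subst ln_le_cancel_iff) (auto simp: ln_max_cap_log(1)[OF s] M_def)
    also have "\<dots> = ln 2 + N * ln (M (\<alpha> i))"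
      using ln_max_cap_log(1)[OF s, of w "\<alpha> i"] by (simp add: ln_mult ln_realpow M_def)
    finally show ?thesis .
  qed
  have "ln (cmod (hom_eval p (?x \<zeta>) (?y \<zeta>))) = ln (cmod (lead_coeff p)) + (\<Sum>i<n. ln (cmod (?x \<zeta> - \<alpha> i * ?y \<zeta>)))"
    if "\<zeta> \<in> ?R" for \<zeta>
    using nzf[OF that] nz unfolding hom_eval_eq norm_mult prod_norm[symmetric]
    by (subst ln_mult, auto intro!: prod_pos) (subst ln_prod, auto)
  then have "(\<Sum>\<zeta>\<in>?R. ln (cmod (hom_eval p (?x \<zeta>) (?y \<zeta>))))
      = N * ln (cmod (lead_coeff p)) + (\<Sum>\<zeta>\<in>?R. \<Sum>i<n. ln (cmod (?x \<zeta> - \<alpha> i * ?y \<zeta>)))"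
    by (simp add: sum.distrib card)
  also have "(\<Sum>\<zeta>\<in>?R. \<Sum>i<n. ln (cmod (?x \<zeta> - \<alpha> i * ?y \<zeta>))) = (\<Sum>i<n. \<Sum>\<zeta>\<in>?R. ln (cmod (?x \<zeta> - \<alpha> i * ?y \<zeta>)))"
    by (rule sum.swap)
  also have "\<dots> \<le> (\<Sum>i<n. ln 2 + N * ln (M (\<alpha> i)))"
    by (intro sum_mono 2) simp
  also have "N * ln (cmod (lead_coeff p)) + (\<Sum>i<n. ln 2 + N * ln (M (\<alpha> i)))
     = n * (N * cap_height s p w + N / 2 * ln ((1 + s\<^sup>2) * (1 + (cmod w)\<^sup>2)) + ln 2)"
  proof -
    have pos: "0 < 1 + s\<^sup>2" using zero_le_power2[of s] by linarith
    define A B C where "A = (\<Sum>i<n. cap_log s (chordal_sq (\<alpha> i) w))"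
      and "B = (\<Sum>i<n. ln (1 + (cmod (\<alpha> i))\<^sup>2))" and "C = ln (1 + s\<^sup>2) + ln (1 + (cmod w)\<^sup>2)"
    have "(\<Sum>i<n. ln 2 + N * ln (M (\<alpha> i))) = n * ln 2 + N * (A + B / 2 + n * C / 2)"
      unfolding M_def ln_max_cap_log(2)[OF s]
      by (simp add: A_def B_def C_def sum.distrib sum_distrib_left sum_divide_distrib algebra_simps add_divide_distrib)
    moreover have "n * (N * cap_height s p w) = N * (ln (cmod (lead_coeff p)) + B / 2 + A)"
      using cap_height_eq[of s w] h_FS_eq by (simp add: A_def B_def)
    moreover have "ln ((1 + s\<^sup>2) * (1 + (cmod w)\<^sup>2)) = C"
      using pos by (simp add: C_def ln_mult)
    ultimately show ?thesis by (simp add: algebra_simps)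
  qed
  finally show ?thesis by simp
qed

lemma has_bochner_integral_cap_height:
  assumes "0 < degree p"
  shows "has_bochner_integral fs_measure (cap_height s p) (h_FS p - 1 / 2)"
proof -
  obtain \<alpha> where "split_poly p \<alpha>" using split_poly_exists[OF assms] .
  then interpret split_poly p \<alpha> .
  have "has_bochner_integral fs_measure (\<lambda>w. h_FS p + (\<Sum>i<n. cap_log s (chordal_sq (\<alpha> i) w)) / n)
     (h_FS p * measure fs_measure UNIV + (\<Sum>i<n. - 1 / 2) / n)"
    using finite_measure.integrable_const[OF finite_measure_fs_measure, of "h_FS p"]
    by (intro has_bochner_integral_add has_bochner_integral_divide_zero has_bochner_integral_sum
        has_bochner_integral_cap_log)
       (simp add: has_bochner_integral_iff mult.commute)
  then show ?thesis
    using degree_pos by (simp add: cap_height_def[abs_def] sum_proots measure_fs_UNIV)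
qed

lemma cap_height_measurable [measurable]: "cap_height s p \<in> borel_measurable borel"
proof -
  have [measurable]: "(\<lambda>w. \<Sum>\<alpha>\<in>#M. cap_log s (chordal_sq \<alpha> w)) \<in> borel_measurable borel" for M
    by (induction M) simp_all
  show ?thesis unfolding cap_height_def by measurable
qed

lemma AE_fs_measure_finite:
  assumes "finite X" shows "AE w in fs_measure. w \<notin> X"
proof -
  have "AE w in lborel. w \<notin> X" using finite_imp_null_set_lborel[OF assms] by (rule AE_not_in)
  then show ?thesis unfolding fs_measure_def
    by (subst AE_density) (auto elim: AE_mp)
qed

section \<open>Bounds for \<open>cap_height\<close> from the coefficients and from the leading
  term\<close>

definition bound_coeff :: "nat \<Rightarrow> real \<Rightarrow> nat \<Rightarrow> real" where
  "bound_coeff n r k = exp (real n * r) * sqrt (real (n choose k))"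

text \<open>Used in both directions: with Cauchy-Schwarz it bounds a value from above, and by
  pigeonhole it makes some monomial large. Each use costs a factor
  \<open>sqrt (n + 1)\<close>.\<close>

lemma weighted_binomial_sum:
  fixes a b :: real
  shows "(\<Sum>k\<le>n. (sqrt (real (n choose k)) * (a ^ k * b ^ (n - k)))\<^sup>2) = (a\<^sup>2 + b\<^sup>2) ^ n"
proof -
  have "(a\<^sup>2 + b\<^sup>2) ^ n = (\<Sum>k\<le>n. of_nat (n choose k) * (a\<^sup>2) ^ k * (b\<^sup>2) ^ (n - k))"
    by (rule binomial_ring)
  also have "\<dots> = (\<Sum>k\<le>n. (sqrt (real (n choose k)) * (a ^ k * b ^ (n - k)))\<^sup>2)"
    by (intro sum.cong) (simp_all add: power_mult_distrib power_mult[symmetric] mult.commute)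
  finally show ?thesis by simp
qed

lemma norm_poly_le:
  assumes d: "degree p = n" and bd: "\<And>k. k \<le> n \<Longrightarrow> cmod (coeff p k) \<le> bound_coeff n r k"
  shows "cmod (poly p w) \<le> exp (n * r) * sqrt ((real n + 1) * (1 + (cmod w)\<^sup>2) ^ n)"
proof -
  let ?c = "\<lambda>k. sqrt (real (n choose k)) * (cmod w ^ k * 1 ^ (n - k))"
  have "cmod (poly p w) \<le> (\<Sum>k\<le>n. cmod (coeff p k) * cmod w ^ k)"
    unfolding poly_altdef d by (rule order_trans[OF norm_sum]) (simp add: norm_mult norm_power)
  also have "\<dots> \<le> (\<Sum>k\<le>n. exp (n * r) * ?c k)"
    using bd by (intro sum_mono) (auto simp: bound_coeff_def mult.assoc[symmetric] intro: mult_right_mono)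
  also have "\<dots> = exp (n * r) * (\<Sum>k\<le>n. 1 * ?c k)"
    by (simp add: sum_distrib_left)
  also have "\<dots> \<le> exp (n * r) * sqrt ((\<Sum>k\<le>n. 1\<^sup>2) * (\<Sum>k\<le>n. (?c k)\<^sup>2))"
  proof (rule mult_left_mono)
    show "(\<Sum>k\<le>n. 1 * ?c k) \<le> sqrt ((\<Sum>k\<le>n. 1\<^sup>2) * (\<Sum>k\<le>n. (?c k)\<^sup>2))"
      by (rule real_le_rsqrt, rule Cauchy_Schwarz_ineq_sum)
  qed simp
  also have "(\<Sum>k\<le>n. (?c k)\<^sup>2) = ((cmod w)\<^sup>2 + 1\<^sup>2) ^ n" by (rule weighted_binomial_sum)
  finally show ?thesis by (simp add: add.commute)
qed

lemma cap_height_0_le: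
  assumes d: "degree p = n" "0 < n" and bd: "\<And>k. k \<le> n \<Longrightarrow> cmod (coeff p k) \<le> bound_coeff n r k"
    and root: "poly p w \<noteq> 0"
  shows "cap_height 0 p w \<le> r + ln (real n + 1) / (2 * real n)"
proof -
  obtain \<alpha> where "split_poly p \<alpha>" using split_poly_exists[of p] d by metis
  then interpret split_poly p \<alpha> .
  have "ln (cmod (poly p w)) \<le> ln (exp (n * r) * sqrt ((real n + 1) * (1 + (cmod w)\<^sup>2) ^ n))"
  proof (rule ln_le_cancel_iff[THEN iffD2])
    show "0 < cmod (poly p w)" using root by simp
    show *: "cmod (poly p w) \<le> exp (n * r) * sqrt ((real n + 1) * (1 + (cmod w)\<^sup>2) ^ n)"
      using norm_poly_le[OF d(1) bd] by (simp add: add.commute)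
    show "0 < exp (n * r) * sqrt ((real n + 1) * (1 + (cmod w)\<^sup>2) ^ n)"
      using \<open>0 < cmod (poly p w)\<close> * by linarith
  qed
  also have "\<dots> = n * r + (ln (real n + 1) + n * ln (1 + (cmod w)\<^sup>2)) / 2"
    by (simp add: ln_mult ln_sqrt ln_realpow)
  finally have "n * cap_height 0 p w \<le> n * r + ln (real n + 1) / 2"
    using cap_height_0[OF root] d by (simp add: add_divide_distrib)
  then show ?thesis using d by (simp add: field_simps)
qed

text \<open>One branch of the maximum increases in \<open>u\<close> and the other decreases, so the
  minimum is at the crossing \<open>u = s^2 / (1 + s^2)\<close>, where both equal that
  number.\<close>

lemma cap_log_ge:
  assumes s: "0 < s" and u: "0 \<le> u" "u \<le> 1"
  shows "ln s - ln (1 + s\<^sup>2) \<le> cap_log s u"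
proof -
  have pos: "0 < 1 + s\<^sup>2" using zero_le_power2[of s] by linarith
  have "s\<^sup>2 / (1 + s\<^sup>2) \<le> max u (s\<^sup>2 * (1 - u))"
  proof (cases "s\<^sup>2 / (1 + s\<^sup>2) \<le> u")
    case False
    then have "u * (1 + s\<^sup>2) \<le> s\<^sup>2" using pos by (simp add: field_simps)
    then have "s\<^sup>2 * (u * (1 + s\<^sup>2)) \<le> s\<^sup>2 * s\<^sup>2" by (rule mult_left_mono) simp
    then have "s\<^sup>2 / (1 + s\<^sup>2) \<le> s\<^sup>2 * (1 - u)"
      using pos by (simp add: field_simps)
    then show ?thesis by simp
  qed simp
  then have "ln (s\<^sup>2 / (1 + s\<^sup>2)) \<le> ln (max u (s\<^sup>2 * (1 - u)))"
    using s pos by (subst ln_le_cancel_iff) (auto intro: less_le_trans[of 0 "s\<^sup>2 / (1 + s\<^sup>2)"])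
  moreover have "ln (s\<^sup>2 / (1 + s\<^sup>2)) = 2 * ln s - ln (1 + s\<^sup>2)"
    using s pos by (simp add: ln_div ln_realpow)
  ultimately show ?thesis by (simp add: cap_log_def)
qed

text \<open>The floor that limits the damage of exceptional polynomials: it holds at every
  \<open>w\<close>, zeros of \<open>p\<close> included.\<close>

lemma cap_height_ge:
  assumes s: "0 < s" and d: "0 < degree p"
  shows "h_FS p + (ln s - ln (1 + s\<^sup>2)) \<le> cap_height s p w"
proof -
  obtain \<alpha> where "split_poly p \<alpha>" using split_poly_exists[of p] d by metis
  then interpret split_poly p \<alpha> .
  have "(\<Sum>i<n. ln s - ln (1 + s\<^sup>2)) \<le> (\<Sum>i<n. cap_log s (chordal_sq (\<alpha> i) w))"
    by (intro sum_mono cap_log_ge s chordal_sq_nonneg chordal_sq_le_1)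
  then have "n * (h_FS p + (ln s - ln (1 + s\<^sup>2))) \<le> n * cap_height s p w"
    unfolding cap_height_eq by (simp add: algebra_simps)
  then show ?thesis using d by simp
qed

lemma fs_integral_eq: "FS_integral f = (LINT w|fs_measure. f w)"
  if [measurable]: "f \<in> borel_measurable borel"
proof -
  have "(LINT w|fs_measure. f w) = (LINT z|lborel. (1 / (pi * (1 + (cmod z)\<^sup>2)\<^sup>2)) *\<^sub>R f z)"
    unfolding fs_measure_def by (rule integral_density) auto
  also have "\<dots> = (LINT z|lborel. (1 / of_real pi) * (f z / of_real ((1 + (cmod z)\<^sup>2)\<^sup>2)))"
    by (intro Bochner_Integration.integral_cong) (simp_all add: scaleR_conv_of_real)
  also have "\<dots> = FS_integral f"
    unfolding FS_integral_def by (rule integral_mult_right_zero)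
  finally show ?thesis by simp
qed

text \<open>The kernel \<open>cap_log s - cap_log 0 + ln (1 + s\<^sup>2) / 2\<close> is nonnegative, supported in the cap of
  radius \<open>s\<close>, and has the same integral around every point. Averaging \<open>f\<close> against it costs at most
  \<open>\<eta>\<close>, and the averaged zero-counting measure differs from the uniform one by
  \<open>cap_height s p - cap_height 0 p\<close>, whose integral vanishes; so a one-sided bound is enough.\<close>

lemma equidistribution_estimate:
  fixes f :: "complex \<Rightarrow> complex"
  assumes d: "0 < degree p" and s: "0 < s"
    and f [measurable]: "f \<in> borel_measurable borel" and C: "\<And>z. cmod (f z) \<le> C"
    and \<eta>: "\<And>\<alpha> w. chordal_sq \<alpha> w < s\<^sup>2 * (1 - chordal_sq \<alpha> w) \<Longrightarrow> cmod (f \<alpha> - f w) \<le> \<eta>" "0 \<le> \<eta>"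
    and B: "\<And>w. poly p w \<noteq> 0 \<Longrightarrow> cap_height 0 p w \<le> B"
  shows "cmod ((\<Sum>z\<in>#proots p. f z) / degree p - FS_integral f)
     \<le> \<eta> + 4 * C / ln (1 + s\<^sup>2) * (LINT w|fs_measure. max 0 (B - cap_height s p w))"
proof -
  obtain \<alpha> where "split_poly p \<alpha>" using split_poly_exists[OF d] .
  then interpret split_poly p \<alpha> .
  \<comment> \<open>Adding \<open>c\<close> cancels the normalisation of \<open>cap_log s\<close>,
    so that the kernel vanishes off the cap. It is also the integral of the kernel, as the two
    \<open>cap_log\<close> integrals cancel.\<close>
  define c where "c = ln (1 + s\<^sup>2) / 2"
  have c: "0 < c" using s by (simp add: c_def ln_gt_zero)
  have C0: "0 \<le> C" using C[of 0] norm_ge_zero order_trans by blast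
  have intf: "integrable fs_measure f"
    by (rule finite_measure.integrable_const_bound[OF finite_measure_fs_measure, of _ C]) (auto simp: C)
  define \<Phi> where "\<Phi> i w = cap_log s (chordal_sq (\<alpha> i) w) - cap_log 0 (chordal_sq (\<alpha> i) w) + c" for i w
  define Y where "Y w = (\<Sum>i<n. \<Phi> i w) / n" for w
  define D where "D w = max 0 (B - cap_height s p w)" for w
  have \<Phi>I: "has_bochner_integral fs_measure (\<Phi> i) c" for i
    using has_bochner_integral_add[OF has_bochner_integral_diff[OF
        has_bochner_integral_cap_log[of s "\<alpha> i"] has_bochner_integral_cap_log[of 0 "\<alpha> i"]] has_bochner_integral_fs_const[of c]]
    by (simp add: \<Phi>_def[abs_def])
  have YI: "has_bochner_integral fs_measure Y c"
    using has_bochner_integral_divide_zero[OF has_bochner_integral_sum[of "{..<n}" fs_measure \<Phi> "\<lambda>_. c"], of "real n"] \<Phi>I degree_pos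
    by (simp add: Y_def[abs_def])
  have DI: "integrable fs_measure D"
    unfolding D_def using has_bochner_integral_cap_height[OF d, of s] has_bochner_integral_fs_const[of B]
    by (intro Bochner_Integration.integrable_max Bochner_Integration.integrable_diff) (auto simp: has_bochner_integral_iff)
  \<comment> \<open>The integral of \<open>g\<close> is \<open>c\<close> times the discrepancy to be
    estimated. Pointwise, \<open>f (\<alpha> i)\<close> can be replaced by \<open>f w\<close>
    wherever the kernel is nonzero.\<close>
  define g where "g w = (\<Sum>i<n. of_real (\<Phi> i w) * f (\<alpha> i)) / n - c * f w" for w
  have \<Phi>c: "has_bochner_integral fs_measure (\<lambda>w. complex_of_real (\<Phi> i w)) (of_real c)" for i
    using \<Phi>I by (rule has_bochner_integral_of_real)
  have gI: "has_bochner_integral fs_measure g (c * ((\<Sum>i<n. f (\<alpha> i)) / n - (LINT w|fs_measure. f w)))"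
  proof -
    have "has_bochner_integral fs_measure g ((\<Sum>i<n. of_real c * f (\<alpha> i)) / n - c * (LINT w|fs_measure. f w))"
      unfolding g_def using intf
      by (intro has_bochner_integral_diff has_bochner_integral_divide_zero has_bochner_integral_sum
          has_bochner_integral_mult_left \<Phi>c has_bochner_integral_mult_right)
         (auto simp: has_bochner_integral_iff)
    then show ?thesis by (simp add: sum_distrib_left[symmetric] right_diff_distrib)
  qed
  have bound: "cmod (g w) \<le> \<eta> * Y w + C * ((Y w - c) + 2 * D w)" if w: "poly p w \<noteq> 0" for w
  proof -
    have ne: "0 < chordal_sq (\<alpha> i) w" if "i < n" for i
    proof -
      have "w \<noteq> \<alpha> i" using w that by (auto simp: poly_eq)
      then show ?thesis using chordal_sq_nonneg[of "\<alpha> i" w] chordal_sq_eq_0_iff[of "\<alpha> i" w] by linarith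
    qed
    have \<Phi>eq: "\<Phi> i w = (ln (max (chordal_sq (\<alpha> i) w) (s\<^sup>2 * (1 - chordal_sq (\<alpha> i) w))) - ln (chordal_sq (\<alpha> i) w)) / 2" if "i < n" for i
      using ne[OF that] by (simp add: \<Phi>_def cap_log_def c_def field_simps)
    have \<Phi>0: "0 \<le> \<Phi> i w" if "i < n" for i
      unfolding \<Phi>eq[OF that] using ne[OF that] by simp
    have 1: "cmod (of_real (\<Phi> i w) * (f (\<alpha> i) - f w)) \<le> \<eta> * \<Phi> i w" if i: "i < n" for i
    proof (cases "chordal_sq (\<alpha> i) w < s\<^sup>2 * (1 - chordal_sq (\<alpha> i) w)")
      case True
      then show ?thesis
        using \<eta>(1)[OF True] \<Phi>0[OF i] by (simp add: norm_mult mult.commute[of \<eta>] mult_left_mono)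
    next
      case False
      then have "\<Phi> i w = 0" unfolding \<Phi>eq[OF i] by (simp add: max_absorb1)
      then show ?thesis by simp
    qed
    have "(\<Sum>i<n. of_real (\<Phi> i w) * f (\<alpha> i)) / n = (\<Sum>i<n. of_real (\<Phi> i w) * (f (\<alpha> i) - f w)) / n + Y w * f w"
      by (simp add: Y_def right_diff_distrib sum_subtractf diff_divide_distrib sum_distrib_right[symmetric])
    then have "g w = (\<Sum>i<n. of_real (\<Phi> i w) * (f (\<alpha> i) - f w)) / n + (Y w - c) * f w"
      by (simp add: g_def algebra_simps)
    then have "cmod (g w) \<le> cmod ((\<Sum>i<n. of_real (\<Phi> i w) * (f (\<alpha> i) - f w)) / n) + cmod ((Y w - c) * f w)"
      by (metis norm_triangle_ineq)
    also have "cmod ((\<Sum>i<n. of_real (\<Phi> i w) * (f (\<alpha> i) - f w)) / n) \<le> (\<Sum>i<n. \<eta> * \<Phi> i w) / n"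
    proof -
      have "cmod (\<Sum>i<n. of_real (\<Phi> i w) * (f (\<alpha> i) - f w)) \<le> (\<Sum>i<n. \<eta> * \<Phi> i w)"
        by (rule sum_norm_le) (use 1 in simp)
      then show ?thesis by (simp add: norm_divide divide_right_mono)
    qed
    also have "(\<Sum>i<n. \<eta> * \<Phi> i w) / n = \<eta> * Y w" by (simp add: Y_def sum_distrib_left)
    also have "cmod ((Y w - c) * f w) \<le> C * \<bar>Y w - c\<bar>"
    proof -
      have "cmod ((Y w - c) * f w) = \<bar>Y w - c\<bar> * cmod (f w)"
        by (simp add: norm_mult flip: of_real_diff)
      then show ?thesis using C[of w] by (simp add: mult_left_mono mult.commute[of C])
    qed
    \<comment> \<open>With \<open>t = Y w - c\<close> this uses that the absolute value of
      \<open>t\<close> is \<open>t + 2 * max 0 (- t)\<close>; \<open>t\<close> integrates to 0, so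
      only the deficit \<open>D\<close> survives.\<close>
    also have "C * \<bar>Y w - c\<bar> \<le> C * ((Y w - c) + 2 * D w)"
    proof (rule mult_left_mono[OF _ C0])
      have "Y w = cap_height s p w - cap_height 0 p w + c"
        using degree_pos by (simp add: Y_def \<Phi>_def cap_height_def sum_proots sum.distrib sum_subtractf add_divide_distrib diff_divide_distrib)
      then have "c - Y w \<le> D w" using B[OF w] by (simp add: D_def)
      moreover have "0 \<le> D w" by (simp add: D_def)
      ultimately show "\<bar>Y w - c\<bar> \<le> (Y w - c) + 2 * D w" by linarith
    qed
    finally show ?thesis by simp
  qed
  have I2: "has_bochner_integral fs_measure (\<lambda>w. \<eta> * Y w + C * ((Y w - c) + 2 * D w))
      (\<eta> * c + C * ((c - c) + 2 * (LINT w|fs_measure. D w)))"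
    using DI by (intro has_bochner_integral_add has_bochner_integral_diff has_bochner_integral_mult_right YI has_bochner_integral_fs_const)
      (simp add: has_bochner_integral_iff)
  have "cmod (LINT w|fs_measure. g w) \<le> (LINT w|fs_measure. cmod (g w))"
    by (rule integral_norm_bound)
  also have "\<dots> \<le> (LINT w|fs_measure. \<eta> * Y w + C * ((Y w - c) + 2 * D w))"
  proof (rule integral_mono_AE)
    show "integrable fs_measure (\<lambda>w. cmod (g w))"
      using gI by (auto simp: has_bochner_integral_iff)
    show "integrable fs_measure (\<lambda>w. \<eta> * Y w + C * ((Y w - c) + 2 * D w))"
      using I2 by (simp add: has_bochner_integral_iff)
    have "AE w in fs_measure. w \<notin> {w. poly p w = 0}"
      by (intro AE_fs_measure_finite poly_roots_finite nz)
    then show "AE w in fs_measure. cmod (g w) \<le> \<eta> * Y w + C * ((Y w - c) + 2 * D w)"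
      by eventually_elim (use bound in auto)
  qed
  also have "\<dots> = \<eta> * c + C * (2 * (LINT w|fs_measure. D w))"
    using I2 by (simp add: has_bochner_integral_iff)
  also have "(LINT w|fs_measure. g w) = c * ((\<Sum>z\<in>#proots p. f z) / n - FS_integral f)"
    using gI by (simp add: has_bochner_integral_iff sum_proots fs_integral_eq)
  also have "cmod (c * ((\<Sum>z\<in>#proots p. f z) / n - FS_integral f)) = c * cmod ((\<Sum>z\<in>#proots p. f z) / n - FS_integral f)"
    using c by (simp add: norm_mult)
  finally have "cmod ((\<Sum>z\<in>#proots p. f z) / n - FS_integral f) \<le> (\<eta> * c + C * (2 * (LINT w|fs_measure. D w))) / c"
    using c by (simp add: pos_le_divide_eq mult.commute)
  also have "\<dots> = \<eta> + 4 * C / ln (1 + s\<^sup>2) * (LINT w|fs_measure. D w)"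
    using c by (simp add: c_def field_simps)
  finally show ?thesis by (simp add: D_def)
qed

section \<open>Counting integer polynomials with a small value\<close>

definition box_polys :: "nat \<Rightarrow> (nat \<Rightarrow> int set) \<Rightarrow> int poly set" where
  "box_polys n S = {P. (\<forall>k\<le>n. coeff P k \<in> S k) \<and> (\<forall>k>n. coeff P k = 0)}"

text \<open>The box is the product of the choices for coefficient \<open>k\<close> and for the other
  coefficients, so a bound on every slice gives one on the whole. The form without division also
  covers an empty \<open>S k\<close>.\<close>

lemma card_box_polys_slice:
  assumes fin: "finite (box_polys n S)" and k: "k \<le> n" and S: "finite (S k)"
    and m: "\<And>R. card {a \<in> S k. Q (R + monom a k)} \<le> m"
  shows "card {P \<in> box_polys n S. Q P} * card (S k) \<le> m * card (box_polys n S)"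
proof (cases "S k = {}")
  case False
  then obtain a0 where a0: "a0 \<in> S k" by blast
  \<comment> \<open>The index set of the slices: all coefficients but the one at \<open>k\<close>,
    which is set to 0.\<close>
  define X where "X = {R. coeff R k = 0 \<and> (\<forall>j\<le>n. j \<noteq> k \<longrightarrow> coeff R j \<in> S j) \<and> (\<forall>j>n. coeff R j = 0)}"
  let ?\<phi> = "\<lambda>(R, a). R + monom a k"
  have inj: "inj_on ?\<phi> (X \<times> UNIV)"
  proof (rule inj_onI, clarify)
    fix R a R' a' assume *: "R \<in> X" "R' \<in> X" "R + monom a k = R' + monom a' k"
    have "coeff (R + monom a k) k = coeff (R' + monom a' k) k" using * by simp
    then have "coeff R k + a = coeff R' k + a'" by (simp only: coeff_add coeff_monom if_True simp_thms)
    then have "a = a'" using *(1,2) by (simp add: X_def)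
    then show "R = R' \<and> a = a'" using * by simp
  qed
  have dec: "P = ?\<phi> (P - monom (coeff P k) k, coeff P k)" for P :: "int poly" by simp
  have decX: "P - monom (coeff P k) k \<in> X" if "P \<in> box_polys n S" for P
    using that k by (auto simp: X_def box_polys_def)
  have \<phi>box: "?\<phi> (R, a) \<in> box_polys n S" if "R \<in> X" "a \<in> S k" for R a
    using that k by (auto simp: X_def box_polys_def coeff_monom)
  have box: "box_polys n S = ?\<phi> ` (X \<times> S k)"
  proof
    show "box_polys n S \<subseteq> ?\<phi> ` (X \<times> S k)"
    proof
      fix P assume P: "P \<in> box_polys n S"
      then have "coeff P k \<in> S k" using k by (auto simp: box_polys_def)
      then show "P \<in> ?\<phi> ` (X \<times> S k)" using dec[of P] decX[OF P] by blast
    qed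
    show "?\<phi> ` (X \<times> S k) \<subseteq> box_polys n S" using \<phi>box by blast
  qed
  have finX: "finite X"
  proof (rule finite_subset)
    show "X \<subseteq> (\<lambda>P. P - monom (coeff P k) k) ` box_polys n S"
    proof
      fix R assume R: "R \<in> X"
      then have "R = (\<lambda>P. P - monom (coeff P k) k) (R + monom a0 k)" by (simp add: X_def)
      then show "R \<in> (\<lambda>P. P - monom (coeff P k) k) ` box_polys n S"
        using \<phi>box[OF R a0] by (metis (no_types, lifting) case_prod_conv image_eqI)
    qed
  qed (use fin in simp)
  have cbox: "card (box_polys n S) = card X * card (S k)"
    unfolding box by (subst card_image) (auto intro: inj_on_subset[OF inj] simp: card_cartesian_product)
  have "{P \<in> box_polys n S. Q P} = ?\<phi> ` (SIGMA R:X. {a \<in> S k. Q (R + monom a k)})"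
    unfolding box by force
  then have "card {P \<in> box_polys n S. Q P} = card (SIGMA R:X. {a \<in> S k. Q (R + monom a k)})"
    by (simp add: card_image inj_on_subset[OF inj] subset_iff)
  also have "\<dots> = (\<Sum>R\<in>X. card {a \<in> S k. Q (R + monom a k)})"
    using finX S by (subst card_SigmaI) auto
  also have "\<dots> \<le> (\<Sum>R\<in>X. m)" by (rule sum_mono) (rule m)
  also have "\<dots> = card X * m" by simp
  finally have "card {P \<in> box_polys n S. Q P} * card (S k) \<le> card X * m * card (S k)"
    by (rule mult_right_mono) simp
  then show ?thesis by (simp add: cbox mult.commute mult.left_commute)
qed simp

lemma card_int_le_diameter:
  fixes A :: "int set" and L :: real
  assumes fin: "finite A" and L: "0 \<le> L" and d: "\<And>a b. a \<in> A \<Longrightarrow> b \<in> A \<Longrightarrow> real_of_int \<bar>a - b\<bar> \<le> L"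
  shows "real (card A) \<le> L + 1"
proof (cases "A = {}")
  case False
  have "A \<subseteq> {Min A..Max A}" using fin by auto
  then have "card A \<le> card {Min A..Max A}" by (rule card_mono[rotated]) simp
  moreover have "Min A \<le> Max A" using fin False by (meson Max_ge Min_in)
  ultimately have "real (card A) \<le> real_of_int (Max A - Min A + 1)" by simp
  moreover have "real_of_int \<bar>Max A - Min A\<bar> \<le> L" using fin False by (intro d) auto
  ultimately show ?thesis by simp
qed (use L in simp)

section \<open>Polynomials of bounded height as the integer points of a box\<close>

abbreviation poly_height_le :: "nat \<Rightarrow> real \<Rightarrow> int poly \<Rightarrow> bool" where
  "poly_height_le n r P \<equiv> (\<forall>k\<le>n. real_of_int \<bar>coeff P k\<bar> \<le> bound_coeff n r k)"

lemma degree_complex_of_int_poly [simp]: "degree (complex_of_int_poly P) = degree P"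
  by (simp add: degree_map_poly)

lemma coeff_complex_of_int_poly [simp]: "coeff (complex_of_int_poly P) k = of_int (coeff P k)"
  by (simp add: coeff_map_poly)

text \<open>The nonzero leading coefficient makes the maximum in \<open>h_B\<close> positive, so the
  logarithm can be removed and the bound read off for each coefficient.\<close>

lemma mem_bounded_int_polys_iff:
  assumes n: "1 \<le> n"
  shows "P \<in> bounded_int_polys n r \<longleftrightarrow> degree P = n \<and> poly_height_le n r P"
proof (cases "degree P = n")
  case True
  define g where "g k = real_of_int \<bar>coeff P k\<bar> / sqrt (real (n choose k))" for k
  have "lead_coeff P \<noteq> 0" using True n by auto
  then have "0 < g n" using True by (simp add: g_def)
  then have pos: "0 < Max (g ` {0..n})"
    by (subst Max_gr_iff) auto
  have "P \<in> bounded_int_polys n r \<longleftrightarrow> 1 / real n * ln (Max (g ` {0..n})) \<le> r"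
    by (simp add: bounded_int_polys_def True h_B_def g_def[abs_def])
  also have "\<dots> \<longleftrightarrow> ln (Max (g ` {0..n})) \<le> n * r"
    using n by (simp add: field_simps)
  also have "\<dots> \<longleftrightarrow> Max (g ` {0..n}) \<le> exp (n * r)"
    using pos by (metis exp_le_cancel_iff exp_ln)
  also have "\<dots> \<longleftrightarrow> (\<forall>k\<le>n. g k \<le> exp (n * r))"
    by (subst Max_le_iff) auto
  also have "\<dots> \<longleftrightarrow> poly_height_le n r P"
  proof (intro all_cong1 imp_cong refl)
    fix k assume "k \<le> n"
    then have "0 < sqrt (real (n choose k))" by simp
    then show "g k \<le> exp (n * r) \<longleftrightarrow> real_of_int \<bar>coeff P k\<bar> \<le> bound_coeff n r k"
      by (simp add: g_def bound_coeff_def pos_divide_le_eq)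
  qed
  finally show ?thesis using True by simp
qed (simp add: bounded_int_polys_def)

text \<open>Removing 0 at \<open>k = n\<close> encodes the exact degree and still leaves a product
  set.\<close>

definition coeff_box :: "nat \<Rightarrow> real \<Rightarrow> nat \<Rightarrow> int set" where
  "coeff_box n r k = {a. real_of_int \<bar>a\<bar> \<le> bound_coeff n r k} - (if k = n then {0} else {})"

lemma bounded_int_polys_eq_box:
  assumes n: "1 \<le> n"
  shows "bounded_int_polys n r = box_polys n (coeff_box n r)"
proof -
  have "degree P = n \<longleftrightarrow> coeff P n \<noteq> 0 \<and> (\<forall>k>n. coeff P k = 0)" for P :: "int poly"
    using n by (metis coeff_eq_0 degree_le le_antisym le_degree leading_coeff_0_iff degree_0 not_one_le_zero)
  then show ?thesis
    using mem_bounded_int_polys_iff[OF n] by (auto simp: box_polys_def coeff_box_def)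
qed

lemma coeff_box_int: "coeff_box n r k = {- \<lfloor>bound_coeff n r k\<rfloor>..\<lfloor>bound_coeff n r k\<rfloor>} - (if k = n then {0} else {})"
proof -
  have "real_of_int \<bar>a\<bar> \<le> b \<longleftrightarrow> a \<in> {- \<lfloor>b\<rfloor>..\<lfloor>b\<rfloor>}" for a b
    by (simp add: le_floor_iff[symmetric] abs_le_iff) linarith
  then show ?thesis by (auto simp: coeff_box_def)
qed

lemma finite_coeff_box: "finite (coeff_box n r k)"
  by (simp add: coeff_box_int)

lemma bound_coeff_ge:
  assumes "k \<le> n" shows "exp (n * r) \<le> bound_coeff n r k"
proof -
  have "1 \<le> sqrt (real (n choose k))" using assms by (simp add: Suc_le_eq)
  then show ?thesis by (simp add: bound_coeff_def)
qed

text \<open>There are \<open>2 * floor b + 1\<close> integers in the interval, and at most one of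
  them, the 0 at the top degree, is missing.\<close>

lemma card_coeff_box:
  assumes k: "k \<le> n"
  shows "2 * (bound_coeff n r k - 1) \<le> real (card (coeff_box n r k))"
proof -
  let ?b = "bound_coeff n r k"
  have b: "0 \<le> \<lfloor>?b\<rfloor>" by (simp add: bound_coeff_def)
  have "card {- \<lfloor>?b\<rfloor>..\<lfloor>?b\<rfloor>} \<le> card (coeff_box n r k) + 1"
    unfolding coeff_box_int using b by (auto simp: card_Diff_singleton_if)
  then have "2 * real_of_int \<lfloor>?b\<rfloor> \<le> real (card (coeff_box n r k))"
    using b by simp
  moreover have "2 * (?b - 1) \<le> 2 * real_of_int \<lfloor>?b\<rfloor>"
    by (intro mult_left_mono less_imp_le[OF real_of_int_floor_gt_diff_one]) simp
  ultimately show ?thesis by (rule order_trans[rotated])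
qed

lemma finite_bounded: "1 \<le> n \<Longrightarrow> finite (box_polys n (coeff_box n r))"
  using finite_bounded_int_polys[of n r] by (simp add: bounded_int_polys_eq_box)

lemma hom_eval_complex_of_int_poly:
  assumes "degree P = n"
  shows "hom_eval (complex_of_int_poly P) x y = (\<Sum>j\<le>n. of_int (coeff P j) * x ^ j * y ^ (n - j))"
  by (simp add: hom_eval_def assms)

text \<open>Some term is at least the mean of the \<open>n + 1\<close> squares, whose sum is
  known.\<close>

lemma exists_large_binomial_term:
  fixes a b :: real
  obtains k where "k \<le> n" "sqrt ((a\<^sup>2 + b\<^sup>2) ^ n / (real n + 1)) \<le> sqrt (real (n choose k)) * \<bar>a ^ k * b ^ (n - k)\<bar>"
proof -
  let ?t = "\<lambda>k. (sqrt (real (n choose k)) * (a ^ k * b ^ (n - k)))\<^sup>2"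
  have "\<exists>k\<le>n. (a\<^sup>2 + b\<^sup>2) ^ n / (real n + 1) \<le> ?t k"
  proof (rule ccontr)
    assume "\<not> ?thesis"
    then have "?t k < (a\<^sup>2 + b\<^sup>2) ^ n / (real n + 1)" if "k \<le> n" for k
      using that by (meson not_le)
    then have "(\<Sum>k\<le>n. ?t k) < (\<Sum>k\<le>n. (a\<^sup>2 + b\<^sup>2) ^ n / (real n + 1))"
      by (intro sum_strict_mono) auto
    then show False unfolding weighted_binomial_sum by (simp add: add.commute)
  qed
  then obtain k where k: "k \<le> n" "(a\<^sup>2 + b\<^sup>2) ^ n / (real n + 1) \<le> ?t k" by blast
  have "sqrt ((a\<^sup>2 + b\<^sup>2) ^ n / (real n + 1)) \<le> sqrt (?t k)" using k(2) by (rule real_sqrt_le_mono)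
  also have "\<dots> = sqrt (real (n choose k)) * \<bar>a ^ k * b ^ (n - k)\<bar>" by (simp add: abs_mult)
  finally show ?thesis using that k(1) by blast
qed

text \<open>Conditionally on all coefficients but the one of the largest monomial, the value at a point is
  confined to an arithmetic progression whose step has the size of that monomial.\<close>

lemma small_values_rare:
  assumes n: "1 \<le> n" and r: "2 \<le> exp (n * r)" and \<delta>: "0 \<le> \<delta>"
    and xy: "0 < (cmod x)\<^sup>2 + (cmod y)\<^sup>2"
  shows "card {P \<in> bounded_int_polys n r. cmod (hom_eval (complex_of_int_poly P) x y)
        \<le> \<delta> * (exp (n * r) * sqrt (((cmod x)\<^sup>2 + (cmod y)\<^sup>2) ^ n / (real n + 1)))}
     \<le> (2 * \<delta> + exp (- (n * r))) * card (bounded_int_polys n r)"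
proof -
  let ?X = "bounded_int_polys n r"
  obtain k where k: "k \<le> n" and big: "sqrt (((cmod x)\<^sup>2 + (cmod y)\<^sup>2) ^ n / (real n + 1))
      \<le> sqrt (real (n choose k)) * \<bar>cmod x ^ k * cmod y ^ (n - k)\<bar>"
    by (rule exists_large_binomial_term)
  define c where "c = x ^ k * y ^ (n - k)"
  define b where "b = bound_coeff n r k"
  define v where "v R = (\<Sum>j\<le>n. of_int (coeff R j) * x ^ j * y ^ (n - j))" for R :: "int poly"
  define Q where "Q R \<longleftrightarrow> cmod (v R) \<le> \<delta> * b * cmod c" for R
  have cm: "cmod c = \<bar>cmod x ^ k * cmod y ^ (n - k)\<bar>" by (simp add: c_def norm_mult norm_power)
  have c: "0 < cmod c"
  proof -
    have "0 < sqrt (((cmod x)\<^sup>2 + (cmod y)\<^sup>2) ^ n / (real n + 1))" using xy by simp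
    then have "0 < sqrt (real (n choose k)) * cmod c" using big unfolding cm by linarith
    then show ?thesis by (simp add: zero_less_mult_iff)
  qed
  have b: "exp (n * r) \<le> b" "2 \<le> b" using bound_coeff_ge[OF k, of r] r by (auto simp: b_def)
  have vadd: "v (R + monom a k) = v R + of_int a * c" for R a
  proof -
    have "v (R + monom a k) = v R + (\<Sum>j\<le>n. of_int (coeff (monom a k) j) * x ^ j * y ^ (n - j))"
      by (simp add: v_def algebra_simps sum.distrib)
    also have "(\<Sum>j\<le>n. of_int (coeff (monom a k) j) * x ^ j * y ^ (n - j))
        = (\<Sum>j\<le>n. if j = k then of_int a * c else 0)"
      by (intro sum.cong) (auto simp: c_def)
    finally show ?thesis using k by simp
  qed
  \<comment> \<open>Two admissible integers differ by at most \<open>2 * \<delta> * b\<close>, as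
    both values lie in the same disc and the step is \<open>c\<close>.\<close>
  define m where "m = nat \<lfloor>2 * \<delta> * b + 1\<rfloor>"
  have slice: "card {a \<in> coeff_box n r k. Q (R + monom a k)} \<le> m" for R
  proof -
    have "real (card {a \<in> coeff_box n r k. Q (R + monom a k)}) \<le> 2 * \<delta> * b + 1"
    proof (rule card_int_le_diameter)
      fix a a' assume "a \<in> {a \<in> coeff_box n r k. Q (R + monom a k)}" "a' \<in> {a \<in> coeff_box n r k. Q (R + monom a k)}"
      then have *: "cmod (v R + of_int a * c) \<le> \<delta> * b * cmod c" "cmod (v R + of_int a' * c) \<le> \<delta> * b * cmod c"
        by (auto simp: Q_def vadd)
      have "real_of_int \<bar>a - a'\<bar> * cmod c = cmod ((v R + of_int a * c) - (v R + of_int a' * c))"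
        by (simp add: norm_mult left_diff_distrib[symmetric] flip: of_int_diff)
      also have "\<dots> \<le> 2 * \<delta> * b * cmod c"
        using norm_triangle_ineq4[of "v R + of_int a * c" "v R + of_int a' * c"] * by linarith
      finally show "real_of_int \<bar>a - a'\<bar> \<le> 2 * \<delta> * b" using c by simp
    qed (use finite_coeff_box \<delta> b in auto)
    then show ?thesis unfolding m_def by (rule le_nat_floor)
  qed
  have "card {P \<in> ?X. Q P} * card (coeff_box n r k) \<le> m * card ?X"
    unfolding bounded_int_polys_eq_box[OF n]
    using card_box_polys_slice[OF finite_bounded[OF n] k finite_coeff_box slice] .
  then have "real (card {P \<in> ?X. Q P} * card (coeff_box n r k)) \<le> real (m * card ?X)"
    by (rule of_nat_mono)
  then have 1: "card {P \<in> ?X. Q P} * real (card (coeff_box n r k)) \<le> m * real (card ?X)" by simp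
  \<comment> \<open>Here \<open>2 \<le> b\<close> is used: it gives
    \<open>b \<le> 2 * (b - 1)\<close>, which bounds the number of choices from below. Dividing by
    \<open>b\<close> later turns the \<open>+ 1\<close> of the count into at most
    \<open>exp (- (n * r))\<close>.\<close>
  have "card {P \<in> ?X. Q P} * b \<le> card {P \<in> ?X. Q P} * real (card (coeff_box n r k))"
    using card_coeff_box[OF k, of r] b by (intro mult_left_mono) (auto simp: b_def)
  also note 1
  also have "m * real (card ?X) \<le> (2 * \<delta> * b + 1) * card ?X"
    using \<delta> b by (intro mult_right_mono) (auto simp: m_def)
  finally have "card {P \<in> ?X. Q P} \<le> (2 * \<delta> * b + 1) * card ?X / b"
    using b by (simp add: pos_le_divide_eq)
  also have "\<dots> = (2 * \<delta> + 1 / b) * card ?X" using b by (simp add: field_simps)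
  also have "\<dots> \<le> (2 * \<delta> + exp (- (n * r))) * card ?X"
  proof (intro mult_right_mono add_left_mono)
    show "1 / b \<le> exp (- (n * r))" using b by (simp add: exp_minus inverse_eq_divide frac_le)
  qed simp
  finally have 2: "card {P \<in> ?X. Q P} \<le> (2 * \<delta> + exp (- (n * r))) * card ?X" .
  have "card {P \<in> ?X. cmod (hom_eval (complex_of_int_poly P) x y)
        \<le> \<delta> * (exp (n * r) * sqrt (((cmod x)\<^sup>2 + (cmod y)\<^sup>2) ^ n / (real n + 1)))} \<le> card {P \<in> ?X. Q P}"
  proof (rule card_mono)
    show "finite {P \<in> ?X. Q P}" using finite_bounded_int_polys[OF n] by simp
    have "\<delta> * (exp (n * r) * sqrt (((cmod x)\<^sup>2 + (cmod y)\<^sup>2) ^ n / (real n + 1))) \<le> \<delta> * b * cmod c"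
      using big \<delta> unfolding cm[symmetric] b_def bound_coeff_def by (simp add: mult_left_mono mult.assoc)
    then show "{P \<in> ?X. cmod (hom_eval (complex_of_int_poly P) x y)
        \<le> \<delta> * (exp (n * r) * sqrt (((cmod x)\<^sup>2 + (cmod y)\<^sup>2) ^ n / (real n + 1)))} \<subseteq> {P \<in> ?X. Q P}"
      by (auto simp: mem_bounded_int_polys_iff[OF n] hom_eval_complex_of_int_poly Q_def v_def)
  qed
  then show ?thesis using 2 by linarith
qed

text \<open>The shortfall of the smoothed height from the deterministic upper bound at
  \<open>s = 0\<close>. Both limits follow once its mean over \<open>P\<close> and \<open>w\<close>
  tends to 0.\<close>

definition height_gap :: "real \<Rightarrow> nat \<Rightarrow> real \<Rightarrow> int poly \<Rightarrow> complex \<Rightarrow> real" where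
  "height_gap s n r P w = max 0 (r + ln (real n + 1) / (2 * real n) - cap_height s (complex_of_int_poly P) w)"

lemma h_FS_of_int_poly_nonneg:
  assumes "0 < degree P" shows "0 \<le> h_FS (complex_of_int_poly P)"
proof -
  have "P \<noteq> 0" using assms by auto
  then have "lead_coeff P \<noteq> 0" by simp
  then have "1 \<le> \<bar>lead_coeff P\<bar>" by linarith
  then have "1 \<le> cmod (lead_coeff (complex_of_int_poly P))"
    by (simp del: leading_coeff_0_iff)
  then have "0 \<le> ln (cmod (lead_coeff (complex_of_int_poly P)))" by (rule ln_ge_zero)
  moreover have "0 \<le> (\<Sum>\<alpha>\<in>#M. ln (1 + (cmod \<alpha>)\<^sup>2))" for M
    by (induction M) (simp_all add: ln_ge_zero)
  ultimately show ?thesis unfolding h_FS_def by (intro add_nonneg_nonneg mult_nonneg_nonneg) auto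
qed

text \<open>The logarithm of the threshold is averaged over the sample points and divided by
  \<open>n\<close>; the factors \<open>(1 + s^2) * (1 + (cmod w)^2)\<close> cancel, and
  \<open>ln 2 / N\<close> is the cost of sampling.\<close>

lemma cap_height_lower:
  fixes w :: complex
  assumes d: "degree p = n" "1 \<le> n" and N: "1 \<le> N" and s: "0 < s" and \<delta>: "0 < \<delta>"
    and big: "\<And>\<zeta>::complex. \<zeta> ^ N = 1 \<Longrightarrow>
      \<delta> * (exp (n * r) * sqrt (((1 + s\<^sup>2) * (1 + (cmod w)\<^sup>2)) ^ n / (real n + 1)))
        < cmod (hom_eval p (w + s * \<zeta>) (1 - cnj w * (s * \<zeta>)))"
  shows "r + ln \<delta> / n - ln (real n + 1) / (2 * real n) - ln 2 / N \<le> cap_height s p w"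
proof -
  obtain \<alpha> where "split_poly p \<alpha>" using split_poly_exists[of p] d by (metis zero_less_one le_trans less_le_trans)
  then interpret sp: split_poly p \<alpha> .
  let ?L = "ln ((1 + s\<^sup>2) * (1 + (cmod w)\<^sup>2))"
  have pos: "0 < (1 + s\<^sup>2) * (1 + (cmod w)\<^sup>2)"
    using zero_le_power2[of s] by (intro mult_pos_pos) (auto intro: add_pos_nonneg)
  let ?T = "\<delta> * (exp (n * r) * sqrt (((1 + s\<^sup>2) * (1 + (cmod w)\<^sup>2)) ^ n / (real n + 1)))"
  have T: "0 < ?T" using \<delta> pos by simp
  have lnT: "ln ?T = ln \<delta> + n * r + (n * ?L - ln (real n + 1)) / 2"
  proof -
    define q where "q = (1 + s\<^sup>2) * (1 + (cmod w)\<^sup>2)"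
    have "0 < q" using pos by (simp add: q_def)
    then show ?thesis unfolding q_def[symmetric]
      using \<delta> by (simp add: ln_mult ln_sqrt ln_div ln_realpow add.commute)
  qed
  have card: "card {\<zeta>::complex. \<zeta> ^ N = 1} = N"
    using card_complex_roots_unity[OF N] .
  have "N * ln ?T = (\<Sum>\<zeta>::complex | \<zeta> ^ N = 1. ln ?T)" by (simp add: card)
  also have "\<dots> \<le> (\<Sum>\<zeta>::complex | \<zeta> ^ N = 1. ln (cmod (hom_eval p (w + s * \<zeta>) (1 - cnj w * (s * \<zeta>)))))"
  proof (rule sum_mono)
    fix \<zeta> :: complex assume "\<zeta> \<in> {\<zeta>. \<zeta> ^ N = 1}"
    then have "?T < cmod (hom_eval p (w + s * \<zeta>) (1 - cnj w * (s * \<zeta>)))" using big by simp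
    then show "ln ?T \<le> ln (cmod (hom_eval p (w + s * \<zeta>) (1 - cnj w * (s * \<zeta>))))"
      using T by (intro ln_le_cancel_iff[THEN iffD2]) auto
  qed
  also have "\<dots> \<le> n * (N * cap_height s p w + N / 2 * ?L + ln 2)"
    unfolding d(1)[symmetric]
  proof (rule sp.sum_ln_hom_eval_le[OF N s])
    show "hom_eval p (w + s * \<zeta>) (1 - cnj w * (s * \<zeta>)) \<noteq> 0" if "\<zeta> ^ N = 1" for \<zeta> :: complex
      using big[OF that] T by auto
  qed
  finally have "N * (ln \<delta> + n * r + (n * ?L - ln (real n + 1)) / 2) \<le> n * (N * cap_height s p w + N / 2 * ?L + ln 2)"
    unfolding lnT .
  then have "N * ln \<delta> + N * n * r - N * ln (real n + 1) / 2 - n * ln 2 \<le> n * N * cap_height s p w"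
    by (simp add: algebra_simps add_divide_distrib diff_divide_distrib)
  moreover have "n * N * (r + ln \<delta> / n - ln (real n + 1) / (2 * real n) - ln 2 / N) = N * ln \<delta> + N * n * r - N * ln (real n + 1) / 2 - n * ln 2"
    using d N by (simp add: field_simps)
  ultimately have "n * N * (r + ln \<delta> / n - ln (real n + 1) / (2 * real n) - ln 2 / N) \<le> n * N * cap_height s p w" by simp
  then show ?thesis using d N by (subst (asm) mult_le_cancel_left_pos) auto
qed

text \<open>Off the set \<open>Bad\<close> the gap is at most \<open>E\<close>, in which the upper
  bound and the threshold each contribute \<open>ln (n + 1) / (2 * n)\<close>. On \<open>Bad\<close>
  the floor for \<open>cap_height\<close> gives \<open>H\<close>, and a union bound over the
  \<open>N\<close> sample points controls the size of \<open>Bad\<close>.\<close>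

lemma sum_height_gap_le:
  fixes w :: complex and r :: real and N :: nat
  assumes n: "1 \<le> n" and r0: "0 \<le> r" and r: "2 \<le> exp (n * r)" and N: "1 \<le> N" and s: "0 < s"
    and \<delta>: "0 < \<delta>" "\<delta> \<le> 1"
  shows "(\<Sum>P\<in>bounded_int_polys n r. height_gap s n r P w) \<le>
    (ln (real n + 1) / n - ln \<delta> / n + ln 2 / N
      + N * (2 * \<delta> + exp (- (n * r))) * (r + ln (real n + 1) / (2 * real n) + ln (1 + s\<^sup>2) - ln s)) * card (bounded_int_polys n r)"
proof -
  let ?X = "bounded_int_polys n r"
  let ?T = "\<delta> * (exp (n * r) * sqrt (((1 + s\<^sup>2) * (1 + (cmod w)\<^sup>2)) ^ n / (real n + 1)))"
  define E where "E = ln (real n + 1) / n - ln \<delta> / n + ln 2 / N"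
  define H where "H = r + ln (real n + 1) / (2 * real n) + ln (1 + s\<^sup>2) - ln s"
  define bad where "bad \<zeta> = {P \<in> ?X. cmod (hom_eval (complex_of_int_poly P) (w + s * \<zeta>) (1 - cnj w * (s * \<zeta>))) \<le> ?T}" for \<zeta> :: complex
  define Bad where "Bad = (\<Union>\<zeta>\<in>{\<zeta>. \<zeta> ^ N = 1}. bad \<zeta>)"
  have finX: "finite ?X" by (rule finite_bounded_int_polys[OF n])
  have card: "card {\<zeta>::complex. \<zeta> ^ N = 1} = N" using card_complex_roots_unity[OF N] .
  have "s \<le> 1 + s\<^sup>2"
    using sum_squares_ge_zero[of "s - 1" 0] zero_le_power2[of "s - 1"] s by (simp add: power2_eq_square algebra_simps)
  then have "ln s \<le> ln (1 + s\<^sup>2)" using s by (intro ln_le_cancel_iff[THEN iffD2]) (auto intro: add_pos_nonneg)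
  moreover have "0 \<le> ln (real n + 1) / (2 * real n)" by simp
  ultimately have H: "0 \<le> H" using r0 unfolding H_def by linarith
  have "ln \<delta> / n \<le> 0" using \<delta> by (simp add: divide_nonpos_nonneg)
  moreover have "0 \<le> ln (real n + 1) / n" "0 \<le> ln 2 / N" by simp_all
  ultimately have E: "0 \<le> E" unfolding E_def by linarith
  have "card (bad \<zeta>) \<le> (2 * \<delta> + exp (- (n * r))) * card ?X" if "\<zeta> ^ N = 1" for \<zeta>
  proof -
    have "cmod \<zeta> ^ N = 1 ^ N" using that by (metis norm_one norm_power power_one)
    then have \<zeta>: "cmod \<zeta> = 1" using N by (metis norm_ge_zero power_eq_iff_eq_base zero_le_one zero_less_one less_le_trans)
    \<comment> \<open>All sample points have homogeneous coordinates of the same norm, so one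
      threshold \<open>?T\<close> serves for every \<open>\<zeta>\<close>.\<close>
    have "(cmod (w + s * \<zeta>))\<^sup>2 + (cmod (1 - cnj w * (s * \<zeta>)))\<^sup>2
        = (cmod (w - (- s * \<zeta>)))\<^sup>2 + (cmod (1 + cnj (- s * \<zeta>) * w))\<^sup>2"
      using cmod_one_plus_cnj_commute[of "- s * \<zeta>" w] by simp
    also have "\<dots> = (1 + (cmod w)\<^sup>2) * (1 + s\<^sup>2)"
      unfolding cmod_diff_add_cmod_one_plus by (simp add: norm_mult \<zeta>)
    finally have e: "(cmod (w + s * \<zeta>))\<^sup>2 + (cmod (1 - cnj w * (s * \<zeta>)))\<^sup>2 = (1 + s\<^sup>2) * (1 + (cmod w)\<^sup>2)"
      by (simp add: mult.commute)
    have "0 < (1 + s\<^sup>2) * (1 + (cmod w)\<^sup>2)"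
      using zero_le_power2[of s] by (intro mult_pos_pos) (auto intro: add_pos_nonneg)
    then show ?thesis
      using small_values_rare[OF n r, of \<delta> "w + s * \<zeta>" "1 - cnj w * (s * \<zeta>)"] \<delta> unfolding e bad_def by simp
  qed
  then have cBad: "card Bad \<le> N * (2 * \<delta> + exp (- (n * r))) * card ?X"
  proof -
    have fin: "finite {\<zeta>::complex. \<zeta> ^ N = 1}" using card N by (auto intro: card_ge_0_finite)
    have "card Bad \<le> (\<Sum>\<zeta>::complex | \<zeta> ^ N = 1. card (bad \<zeta>))"
      unfolding Bad_def by (rule card_UN_le[OF fin])
    then have "real (card Bad) \<le> (\<Sum>\<zeta>::complex | \<zeta> ^ N = 1. real (card (bad \<zeta>)))"
      by (metis of_nat_le_iff of_nat_sum)
    also have "\<dots> \<le> (\<Sum>\<zeta>::complex | \<zeta> ^ N = 1. (2 * \<delta> + exp (- (n * r))) * card ?X)"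
      by (intro sum_mono) (use \<open>\<And>\<zeta>. \<zeta> ^ N = 1 \<Longrightarrow> card (bad \<zeta>) \<le> (2 * \<delta> + exp (- (n * r))) * card ?X\<close> in simp)
    also have "\<dots> = N * (2 * \<delta> + exp (- (n * r))) * card ?X" by (simp add: card)
    finally show ?thesis .
  qed
  have gap: "height_gap s n r P w \<le> E + (if P \<in> Bad then H else 0)" if P: "P \<in> ?X" for P
  proof (cases "P \<in> Bad")
    case True
    have d: "degree P = n" using P by (simp add: mem_bounded_int_polys_iff[OF n])
    have "0 \<le> h_FS (complex_of_int_poly P)" by (rule h_FS_of_int_poly_nonneg) (use d n in simp)
    then have "ln s - ln (1 + s\<^sup>2) \<le> cap_height s (complex_of_int_poly P) w"
      using cap_height_ge[OF s, of "complex_of_int_poly P" w] d n by simp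
    then have "height_gap s n r P w \<le> H" using H by (simp add: height_gap_def H_def)
    then show ?thesis using True E by simp
  next
    case False
    have d: "degree (complex_of_int_poly P) = n" using P by (simp add: mem_bounded_int_polys_iff[OF n])
    have "r + ln \<delta> / n - ln (real n + 1) / (2 * real n) - ln 2 / N \<le> cap_height s (complex_of_int_poly P) w"
    proof (rule cap_height_lower[OF d n N s \<delta>(1)])
      show "?T < cmod (hom_eval (complex_of_int_poly P) (w + s * \<zeta>) (1 - cnj w * (s * \<zeta>)))" if "\<zeta> ^ N = 1" for \<zeta> :: complex
        using False P that by (auto simp: Bad_def bad_def not_le)
    qed
    moreover have "ln (real n + 1) / (2 * real n) + ln (real n + 1) / (2 * real n) = ln (real n + 1) / n" by simp
    ultimately have "r + ln (real n + 1) / (2 * real n) - cap_height s (complex_of_int_poly P) w \<le> E"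
      unfolding E_def by linarith
    then show ?thesis using False E by (simp add: height_gap_def)
  qed
  have "(\<Sum>P\<in>?X. height_gap s n r P w) \<le> (\<Sum>P\<in>?X. E + (if P \<in> Bad then H else 0))"
    by (intro sum_mono gap)
  also have "\<dots> = E * card ?X + H * card (?X \<inter> Bad)"
    using finX by (simp add: sum.distrib sum.If_cases)
  also have "?X \<inter> Bad = Bad" by (auto simp: Bad_def bad_def)
  also have "E * card ?X + H * card Bad \<le> E * card ?X + H * (N * (2 * \<delta> + exp (- (n * r))) * card ?X)"
    using cBad H by (intro add_left_mono mult_left_mono)
  finally show ?thesis by (simp add: E_def H_def algebra_simps)
qed

section \<open>Averages over finite sets and the mean height gap\<close>

definition average :: "'a set \<Rightarrow> ('a \<Rightarrow> real) \<Rightarrow> real" where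
  "average X g = 1 / real (card X) * (\<Sum>x\<in>X. g x)"

lemma average_mono: "(\<And>x. x \<in> X \<Longrightarrow> g x \<le> h x) \<Longrightarrow> average X g \<le> average X h"
  unfolding average_def by (intro mult_left_mono sum_mono) auto

lemma average_nonneg: "(\<And>x. x \<in> X \<Longrightarrow> 0 \<le> g x) \<Longrightarrow> 0 \<le> average X g"
  unfolding average_def by (intro mult_nonneg_nonneg sum_nonneg) auto

text \<open>An inequality under \<open>0 \<le> a\<close>, because the average over a set of
  cardinality 0 is 0.\<close>

lemma average_affine_le:
  assumes "0 \<le> a"
  shows "average X (\<lambda>x. a + b * g x) \<le> a + b * average X g"
proof (cases "card X = 0")
  case False
  then show ?thesis
    by (simp add: average_def sum.distrib sum_distrib_left[symmetric] field_simps)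
qed (use assms in \<open>simp add: average_def\<close>)

lemma card_bounded_int_polys_pos:
  assumes n: "1 \<le> n" and r: "0 \<le> r" shows "0 < card (bounded_int_polys n r)"
proof -
  have "1 \<le> bound_coeff n r k" if "k \<le> n" for k
    using bound_coeff_ge[OF that, of r] r by (auto intro: order_trans[of 1 "exp (n * r)"])
  then have "monom 1 n \<in> bounded_int_polys n r"
    unfolding mem_bounded_int_polys_iff[OF n]
    by (auto simp: degree_monom_eq coeff_monom intro: order_trans[of 0 1])
  then show ?thesis using finite_bounded_int_polys[OF n] by (auto simp: card_gt_0_iff)
qed

lemma integrable_height_gap:
  assumes "0 < degree P"
  shows "integrable fs_measure (height_gap s n r P)"
proof -
  have "integrable fs_measure (\<lambda>w. max 0 (r + ln (real n + 1) / (2 * real n) - cap_height s (complex_of_int_poly P) w))"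
    using has_bochner_integral_cap_height[of "complex_of_int_poly P" s] assms
      finite_measure.integrable_const[OF finite_measure_fs_measure]
    by (intro Bochner_Integration.integrable_max Bochner_Integration.integrable_diff)
       (auto simp: has_bochner_integral_iff)
  then show ?thesis by (simp add: height_gap_def[abs_def])
qed

text \<open>The bound for the sum over \<open>P\<close> is uniform in \<open>w\<close> and the
  measure has mass 1, so it survives the exchange of the finite sum with the integral.\<close>

lemma average_height_gap_le:
  fixes r :: real and N :: nat
  assumes n: "1 \<le> n" and r0: "0 \<le> r" and r: "2 \<le> exp (n * r)" and N: "1 \<le> N" and s: "0 < s"
    and \<delta>: "0 < \<delta>" "\<delta> \<le> 1"
  shows "average (bounded_int_polys n r) (\<lambda>P. LINT w|fs_measure. height_gap s n r P w) \<le>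
    ln (real n + 1) / n - ln \<delta> / n + ln 2 / N
      + N * (2 * \<delta> + exp (- (n * r))) * (r + ln (real n + 1) / (2 * real n) + ln (1 + s\<^sup>2) - ln s)"
    (is "_ \<le> ?R")
proof -
  let ?X = "bounded_int_polys n r"
  have int: "integrable fs_measure (height_gap s n r P)" if "P \<in> ?X" for P
    using that n by (intro integrable_height_gap) (simp add: mem_bounded_int_polys_iff)
  have "(\<Sum>P\<in>?X. LINT w|fs_measure. height_gap s n r P w) = (LINT w|fs_measure. (\<Sum>P\<in>?X. height_gap s n r P w))"
    using int by (intro Bochner_Integration.integral_sum[symmetric]) simp
  also have "\<dots> \<le> (LINT w|fs_measure. ?R * card ?X)"
    using int finite_measure.integrable_const[OF finite_measure_fs_measure]
    by (intro integral_mono Bochner_Integration.integrable_sum sum_height_gap_le assms) auto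
  also have "\<dots> = ?R * card ?X"
    by (simp add: measure_fs_UNIV)
  finally have *: "(\<Sum>P\<in>?X. LINT w|fs_measure. height_gap s n r P w) \<le> ?R * card ?X" .
  show ?thesis
  proof (cases "card ?X = 0")
    case False
    then show ?thesis using * by (simp add: average_def pos_divide_le_eq)
  next
    case True
    then show ?thesis using card_bounded_int_polys_pos[OF n r0] by simp
  qed
qed

section \<open>Limits\<close>

lemma average_height_gap_tendsto_0:
  assumes c: "0 < c" and r: "\<forall>\<^sub>F n in sequentially. c \<le> r n \<and> r n \<le> C" and s: "0 < s"
  shows "(\<lambda>n. average (bounded_int_polys n (r n)) (\<lambda>P. LINT w|fs_measure. height_gap s n (r n) P w)) \<longlonglongrightarrow> 0"
    (is "?A \<longlonglongrightarrow> 0")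
proof (rule order_tendstoI)
  fix a :: real assume "a < 0"
  moreover have "0 \<le> ?A n" for n
    by (intro average_nonneg integral_nonneg_AE AE_I2) (simp add: height_gap_def)
  ultimately show "\<forall>\<^sub>F n in sequentially. a < ?A n"
    by (intro always_eventually allI) (rule less_le_trans)
next
  fix e :: real assume e: "0 < e"
  \<comment> \<open>\<open>N\<close> depends on \<open>e\<close> only and stays fixed as
    \<open>n\<close> grows.\<close>
  obtain N where N: "ln 2 / e < real N" using reals_Archimedean2 by blast
  have "0 < ln 2 / e" using e by simp
  then have N1: "1 \<le> N" using N by (cases N) auto
  have Ne: "ln 2 / N < e" using N N1 e by (simp add: field_simps)
  \<comment> \<open>The choice \<open>\<delta> = 1 / n\<close> makes both
    \<open>ln \<delta> / n\<close> and the exceptional share tend to 0. Replacing \<open>r n\<close>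
    by \<open>c\<close> in the exponential and by \<open>C\<close> in the last factor removes the
    dependence on the sequence.\<close>
  let ?B = "\<lambda>n. (ln (real n + 1) / n - ln (1 / real n) / n) + ln 2 / N
      + N * (2 * (1 / real n) + exp (- (n * c))) * ((C + ln (1 + s\<^sup>2) - ln s) + ln (real n + 1) / (2 * real n))"
  have l1: "(\<lambda>n. ln (real n + 1) / n - ln (1 / real n) / n) \<longlonglongrightarrow> 0" by real_asymp
  have l2: "(\<lambda>n. 2 * (1 / real n) + exp (- (n * c))) \<longlonglongrightarrow> 0" using c by real_asymp
  have l3: "(\<lambda>n. ln (real n + 1) / (2 * real n)) \<longlonglongrightarrow> 0" by real_asymp
  have "?B \<longlonglongrightarrow> 0 + ln 2 / N + real N * 0 * ((C + ln (1 + s\<^sup>2) - ln s) + 0)"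
    by (rule tendsto_add[OF tendsto_add[OF l1 tendsto_const]
        tendsto_mult[OF tendsto_mult[OF tendsto_const l2] tendsto_add[OF tendsto_const l3]]])
  then have ev1: "\<forall>\<^sub>F n in sequentially. ?B n < e"
    by (rule order_tendstoD(2)) (use Ne in simp)
  have ev2: "\<forall>\<^sub>F n in sequentially. 2 \<le> exp (n * c)" using c by real_asymp
  show "\<forall>\<^sub>F n in sequentially. ?A n < e"
    using ev1 ev2 r eventually_ge_at_top[of 1]
  proof eventually_elim
    case (elim n)
    have rn: "0 \<le> r n" using elim c by linarith
    have le: "exp (n * c) \<le> exp (n * r n)" "exp (- (n * r n)) \<le> exp (- (n * c))"
      using elim by (auto intro: mult_left_mono)
    have "s \<le> 1 + s\<^sup>2"
      using zero_le_power2[of "s - 1"] s by (simp add: power2_eq_square algebra_simps)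
    then have "ln s \<le> ln (1 + s\<^sup>2)" using s by (intro ln_le_cancel_iff[THEN iffD2]) (auto intro: add_pos_nonneg)
    moreover have "0 \<le> ln (real n + 1) / (2 * real n)" by simp
    ultimately have H: "0 \<le> C + ln (1 + s\<^sup>2) - ln s + ln (real n + 1) / (2 * real n)"
      using elim rn by linarith
    have "?A n \<le> ln (real n + 1) / n - ln (1 / real n) / n + ln 2 / N
      + N * (2 * (1 / real n) + exp (- (n * r n))) * (r n + ln (real n + 1) / (2 * real n) + ln (1 + s\<^sup>2) - ln s)"
    proof (rule average_height_gap_le)
      show "2 \<le> exp (n * r n)" using elim(2) le(1) by linarith
    qed (use elim rn N1 s in auto)
    also have "\<dots> \<le> ?B n"
    proof -
      have "(2 * (1 / real n) + exp (- (n * r n))) * (r n + ln (real n + 1) / (2 * real n) + ln (1 + s\<^sup>2) - ln s)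
         \<le> (2 * (1 / real n) + exp (- (n * r n))) * ((C + ln (1 + s\<^sup>2) - ln s) + ln (real n + 1) / (2 * real n))"
        using elim by (intro mult_left_mono) auto
      also have "\<dots> \<le> (2 * (1 / real n) + exp (- (n * c))) * ((C + ln (1 + s\<^sup>2) - ln s) + ln (real n + 1) / (2 * real n))"
        using le H by (intro mult_right_mono) auto
      finally have "N * ((2 * (1 / real n) + exp (- (n * r n))) * (r n + ln (real n + 1) / (2 * real n) + ln (1 + s\<^sup>2) - ln s))
        \<le> N * ((2 * (1 / real n) + exp (- (n * c))) * ((C + ln (1 + s\<^sup>2) - ln s) + ln (real n + 1) / (2 * real n)))"
        by (rule mult_left_mono) simp
      then show ?thesis by (simp only: mult.assoc add_le_cancel_left)
    qed
    also note \<open>?B n < e\<close>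
    finally show ?case .
  qed
qed

lemma cap_height_0_le_of_int_poly:
  assumes n: "1 \<le> n" and P: "P \<in> bounded_int_polys n r" and w: "poly (complex_of_int_poly P) w \<noteq> 0"
  shows "cap_height 0 (complex_of_int_poly P) w \<le> r + ln (real n + 1) / (2 * real n)"
  using P w n by (intro cap_height_0_le) (auto simp: mem_bounded_int_polys_iff)

text \<open>The integral of \<open>cap_height\<close> is the same for every \<open>s\<close>:
  \<open>s = 0\<close>, where the deterministic bound holds off the roots, bounds
  \<open>h_FS\<close> from above, and the given \<open>s\<close> bounds it from below.\<close>

lemma h_FS_estimate:
  assumes n: "1 \<le> n" and P: "P \<in> bounded_int_polys n r"
  shows "\<bar>r + 1 / 2 - h_FS (complex_of_int_poly P)\<bar>
    \<le> ln (real n + 1) / (2 * real n) + (LINT w|fs_measure. height_gap s n r P w)"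
proof -
  let ?p = "complex_of_int_poly P" and ?\<epsilon> = "ln (real n + 1) / (2 * real n)"
  have d: "0 < degree ?p" using n P by (simp add: mem_bounded_int_polys_iff)
  then have p0: "?p \<noteq> 0" by (metis degree_0 less_irrefl)
  have I: "has_bochner_integral fs_measure (\<lambda>w. r + ?\<epsilon> - cap_height t ?p w) (r + ?\<epsilon> - (h_FS ?p - 1 / 2))" for t
    by (intro has_bochner_integral_diff has_bochner_integral_fs_const has_bochner_integral_cap_height d)
  have "0 \<le> (LINT w|fs_measure. r + ?\<epsilon> - cap_height 0 ?p w)"
  proof (rule integral_nonneg_AE)
    have "AE w in fs_measure. w \<notin> {w. poly ?p w = 0}"
      by (intro AE_fs_measure_finite poly_roots_finite p0)
    then show "AE w in fs_measure. 0 \<le> r + ?\<epsilon> - cap_height 0 ?p w"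
      by eventually_elim (use cap_height_0_le_of_int_poly[OF n P] in auto)
  qed
  then have "0 \<le> r + ?\<epsilon> - (h_FS ?p - 1 / 2)"
    using I[of 0] by (simp add: has_bochner_integral_iff)
  moreover have "(LINT w|fs_measure. r + ?\<epsilon> - cap_height s ?p w) \<le> (LINT w|fs_measure. height_gap s n r P w)"
    using I[of s] d by (intro integral_mono integrable_height_gap) (auto simp: has_bochner_integral_iff height_gap_def)
  then have "r + ?\<epsilon> - (h_FS ?p - 1 / 2) \<le> (LINT w|fs_measure. height_gap s n r P w)"
    using I[of s] by (simp add: has_bochner_integral_iff)
  moreover have "0 \<le> ?\<epsilon>" by simp
  ultimately show ?thesis by linarith
qed

text \<open>\<open>f\<close> extends continuously to the compact Riemann sphere, hence is uniformly
  continuous for the chordal distance. The argument splits the plane into a large disc and a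
  neighbourhood of infinity where \<open>f\<close> is close to \<open>l\<close>.\<close>

lemma uniformly_continuous_chordal:
  fixes f :: "complex \<Rightarrow> complex"
  assumes f: "continuous_on UNIV f" and l: "(f \<longlongrightarrow> l) at_infinity" and \<eta>: "0 < \<eta>"
  obtains s where "0 < s"
    "\<And>\<alpha> w. chordal_sq \<alpha> w < s\<^sup>2 * (1 - chordal_sq \<alpha> w) \<Longrightarrow> cmod (f \<alpha> - f w) \<le> \<eta>"
proof -
  have "\<forall>\<^sub>F z in at_infinity. dist (f z) l < \<eta> / 2" using l \<eta> by (intro tendstoD) auto
  then obtain R0 where R0: "\<And>z. R0 \<le> cmod z \<Longrightarrow> dist (f z) l < \<eta> / 2"
    by (auto simp: eventually_at_infinity)
  define R where "R = max R0 1"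
  have R: "1 \<le> R" "\<And>z. R \<le> cmod z \<Longrightarrow> dist (f z) l < \<eta> / 2" using R0 by (auto simp: R_def)
  have "uniformly_continuous_on (cball 0 (R + 1)) f"
    by (intro compact_uniformly_continuous continuous_on_subset[OF f]) auto
  then obtain \<delta> where \<delta>: "0 < \<delta>"
    "\<And>x y. cmod x \<le> R + 1 \<Longrightarrow> cmod y \<le> R + 1 \<Longrightarrow> dist x y < \<delta> \<Longrightarrow> dist (f x) (f y) < \<eta>"
    unfolding uniformly_continuous_on_def using \<eta> by (metis mem_cball_0)
  \<comment> \<open>The distance \<open>d\<close> will satisfy
    \<open>d < s * (1 + R^2) + s * R * d\<close>. The last term is at most \<open>d / 2\<close>, so
    \<open>d < 2 * s * (1 + R^2) = min \<delta> 1\<close>; the 1 keeps the other point within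
    \<open>R + 1\<close>.\<close>
  define s where "s = min \<delta> 1 / (2 * (1 + R\<^sup>2))"
  have R2: "0 < 1 + R\<^sup>2" using zero_le_power2[of R] by linarith
  have s: "0 < s" using \<delta> R2 by (simp add: s_def)
  have sR: "s * R \<le> 1 / 2"
  proof -
    have "s * R \<le> 1 / (2 * (1 + R\<^sup>2)) * R"
      unfolding s_def using R R2 by (intro mult_right_mono divide_right_mono) auto
    also have "\<dots> \<le> 1 / 2"
      using R R2 zero_le_power2[of "R - 1"] by (simp add: field_simps power2_eq_square)
    finally show ?thesis .
  qed
  have close: "cmod (w - \<alpha>) < min \<delta> 1" if lt: "cmod (w - \<alpha>) < s * cmod (1 + cnj \<alpha> * w)" and \<alpha>: "cmod \<alpha> \<le> R" for \<alpha> w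
  proof -
    let ?d = "cmod (w - \<alpha>)"
    have "cmod w \<le> ?d + R" using norm_triangle_ineq[of "w - \<alpha>" \<alpha>] \<alpha> by simp
    then have "cmod \<alpha> * cmod w \<le> R * (?d + R)" using \<alpha> R(1) by (intro mult_mono) auto
    then have "cmod (1 + cnj \<alpha> * w) \<le> 1 + R * (?d + R)"
      using norm_triangle_ineq[of 1 "cnj \<alpha> * w"] by (simp add: norm_mult)
    then have "?d < s * (1 + R * (?d + R))" using lt s by (meson less_le_trans mult_left_mono less_imp_le)
    also have "\<dots> = s * (1 + R\<^sup>2) + s * R * ?d" by (simp add: power2_eq_square algebra_simps)
    also have "\<dots> \<le> s * (1 + R\<^sup>2) + 1 / 2 * ?d" using sR by (intro add_left_mono mult_right_mono) auto
    also have "s * (1 + R\<^sup>2) = min \<delta> 1 / 2" using R2 by (simp add: s_def field_simps)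
    finally show ?thesis by linarith
  qed
  have half: "cmod (f \<alpha> - f w) \<le> \<eta>" if lt: "cmod (w - \<alpha>) < s * cmod (1 + cnj \<alpha> * w)" and \<alpha>: "cmod \<alpha> \<le> R" for \<alpha> w
  proof -
    have "cmod w \<le> R + 1" using close[OF lt \<alpha>] norm_triangle_ineq[of "w - \<alpha>" \<alpha>] \<alpha> by simp
    then have "dist (f \<alpha>) (f w) < \<eta>"
      using \<delta>(2)[of \<alpha> w] close[OF lt \<alpha>] \<alpha> by (simp add: dist_norm norm_minus_commute)
    then show ?thesis by (simp add: dist_norm)
  qed
  show ?thesis
  proof (rule that[OF s])
    fix \<alpha> w assume "chordal_sq \<alpha> w < s\<^sup>2 * (1 - chordal_sq \<alpha> w)"
    then have "(cmod (w - \<alpha>))\<^sup>2 < (s * cmod (1 + cnj \<alpha> * w))\<^sup>2"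
      unfolding one_minus_chordal_sq unfolding chordal_sq_def
      by (simp add: divide_less_cancel power_mult_distrib zero_less_mult_iff)
    then have lt: "cmod (w - \<alpha>) < s * cmod (1 + cnj \<alpha> * w)"
      by (rule power_less_imp_less_base) (use s in simp)
    then have lt': "cmod (\<alpha> - w) < s * cmod (1 + cnj w * \<alpha>)"
      by (simp add: norm_minus_commute cmod_one_plus_cnj_commute[of w])
    consider "cmod \<alpha> \<le> R" | "cmod w \<le> R" | "R \<le> cmod \<alpha>" "R \<le> cmod w" by linarith
    then show "cmod (f \<alpha> - f w) \<le> \<eta>"
    proof cases
      case 1
      then show ?thesis using half[OF lt] by simp
    next
      case 2
      then show ?thesis using half[OF lt'] by (simp add: norm_minus_commute)
    next
      case 3
      then have "dist (f \<alpha>) (f w) < \<eta> / 2 + \<eta> / 2"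
        using R(2) by (intro dist_triangle_less_add[of _ l]) (auto simp: dist_commute)
      then show ?thesis by (simp add: dist_norm)
    qed
  qed
qed

lemma bounded_if_limit_at_infinity:
  fixes f :: "complex \<Rightarrow> complex"
  assumes f: "continuous_on UNIV f" and l: "(f \<longlongrightarrow> l) at_infinity"
  obtains C where "\<And>z. cmod (f z) \<le> C"
proof -
  have "\<forall>\<^sub>F z in at_infinity. dist (f z) l < 1" using l by (intro tendstoD) auto
  then obtain R where R: "\<And>z. R \<le> cmod z \<Longrightarrow> dist (f z) l < 1"
    by (auto simp: eventually_at_infinity)
  have "bounded (f ` cball 0 R)"
    by (intro compact_imp_bounded compact_continuous_image continuous_on_subset[OF f]) auto
  then obtain B where "\<forall>x\<in>f ` cball 0 R. cmod x \<le> B"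
    unfolding bounded_iff by blast
  then have B: "\<And>z. cmod z \<le> R \<Longrightarrow> cmod (f z) \<le> B" by simp
  have "cmod (f z) \<le> max B (cmod l + 1)" for z
  proof (cases "cmod z \<le> R")
    case False
    then have "cmod (f z - l) < 1" using R[of z] by (simp add: dist_norm)
    then show ?thesis using norm_triangle_ineq[of "f z - l" l] by simp
  qed (use B in \<open>simp add: le_max_iff_disj\<close>)
  then show ?thesis by (rule that)
qed

lemma average_root_discrepancy_tendsto_0:
  fixes f :: "complex \<Rightarrow> complex"
  assumes c: "0 < c" and r: "\<forall>\<^sub>F n in sequentially. c \<le> r n \<and> r n \<le> C"
    and f: "continuous_on UNIV f" and l: "(f \<longlongrightarrow> l) at_infinity"
  shows "(\<lambda>n. average (bounded_int_polys n (r n)) (\<lambda>P.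
    cmod (1 / of_nat n * (\<Sum>z\<in>#proots (complex_of_int_poly P). f z) - FS_integral f))) \<longlonglongrightarrow> 0"
    (is "?A \<longlonglongrightarrow> 0")
proof (rule order_tendstoI)
  fix a :: real assume "a < 0"
  moreover have "0 \<le> ?A n" for n by (intro average_nonneg) simp
  ultimately show "\<forall>\<^sub>F n in sequentially. a < ?A n"
    by (intro always_eventually allI) (rule less_le_trans)
next
  fix e :: real assume e: "0 < e"
  obtain M where M: "\<And>z. cmod (f z) \<le> M" using bounded_if_limit_at_infinity[OF f l] by blast
  \<comment> \<open>Half of \<open>e\<close> pays for the oscillation of \<open>f\<close> on caps.
    Then \<open>s\<close>, and with it the possibly large factor \<open>?K\<close>, is fixed before
    \<open>n\<close> grows.\<close>
  obtain s where s: "0 < s" "\<And>\<alpha> w. chordal_sq \<alpha> w < s\<^sup>2 * (1 - chordal_sq \<alpha> w) \<Longrightarrow> cmod (f \<alpha> - f w) \<le> e / 2"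
    using uniformly_continuous_chordal[OF f l, of "e / 2"] e by auto
  let ?G = "\<lambda>n. average (bounded_int_polys n (r n)) (\<lambda>P. LINT w|fs_measure. height_gap s n (r n) P w)"
  let ?K = "4 * M / ln (1 + s\<^sup>2)"
  have "(\<lambda>n. e / 2 + ?K * ?G n) \<longlonglongrightarrow> e / 2 + ?K * 0"
    by (intro tendsto_intros average_height_gap_tendsto_0[OF c r s(1)])
  then have ev: "\<forall>\<^sub>F n in sequentially. e / 2 + ?K * ?G n < e"
    by (rule order_tendstoD(2)) (use e in simp)
  show "\<forall>\<^sub>F n in sequentially. ?A n < e"
    using ev eventually_ge_at_top[of 1]
  proof eventually_elim
    case (elim n)
    have "?A n \<le> average (bounded_int_polys n (r n)) (\<lambda>P. e / 2 + ?K * (LINT w|fs_measure. height_gap s n (r n) P w))"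
    proof (rule average_mono)
      fix P assume P: "P \<in> bounded_int_polys n (r n)"
      then have d: "degree P = n" using elim by (simp add: mem_bounded_int_polys_iff)
      have "cmod ((\<Sum>z\<in>#proots (complex_of_int_poly P). f z) / of_nat (degree (complex_of_int_poly P)) - FS_integral f)
         \<le> e / 2 + ?K * (LINT w|fs_measure. max 0 (r n + ln (real n + 1) / (2 * real n) - cap_height s (complex_of_int_poly P) w))"
        using elim d e s M cap_height_0_le_of_int_poly[OF _ P]
        by (intro equidistribution_estimate borel_measurable_continuous_onI[OF f]) auto
      then show "cmod (1 / of_nat n * (\<Sum>z\<in>#proots (complex_of_int_poly P). f z) - FS_integral f)
        \<le> e / 2 + ?K * (LINT w|fs_measure. height_gap s n (r n) P w)"
        by (simp add: height_gap_def d)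
    qed
    also have "\<dots> \<le> e / 2 + ?K * ?G n" using e by (intro average_affine_le) simp
    also note \<open>e / 2 + ?K * ?G n < e\<close>
    finally show ?case .
  qed
qed

lemma average_h_FS_tendsto_0:
  assumes \<tau>: "0 < \<tau>" and r: "r \<longlonglongrightarrow> \<tau>"
  shows "(\<lambda>n. average (bounded_int_polys n (r n)) (\<lambda>P. \<bar>\<tau> + 1 / 2 - h_FS (complex_of_int_poly P)\<bar>)) \<longlonglongrightarrow> 0"
    (is "?A \<longlonglongrightarrow> 0")
proof -
  have "\<forall>\<^sub>F n in sequentially. \<tau> / 2 < r n" "\<forall>\<^sub>F n in sequentially. r n < \<tau> + 1"
    using \<tau> by (intro order_tendstoD[OF r]; simp)+
  then have ev: "\<forall>\<^sub>F n in sequentially. \<tau> / 2 \<le> r n \<and> r n \<le> \<tau> + 1"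
    by eventually_elim auto
  \<comment> \<open>Any fixed positive radius would do in place of 1. The factor \<open>1 *\<close>
    below is kept to match the shape of \<open>average_affine_le\<close>.\<close>
  let ?G = "\<lambda>n. average (bounded_int_polys n (r n)) (\<lambda>P. LINT w|fs_measure. height_gap 1 n (r n) P w)"
  let ?a = "\<lambda>n. \<bar>\<tau> - r n\<bar> + ln (real n + 1) / (2 * real n)"
  have "(\<lambda>n. \<bar>\<tau> - r n\<bar> + ln (real n + 1) / (2 * real n) + 1 * ?G n) \<longlonglongrightarrow> \<bar>\<tau> - \<tau>\<bar> + 0 + 1 * 0"
  proof (intro tendsto_add tendsto_mult tendsto_const tendsto_rabs tendsto_diff r)
    show "(\<lambda>n. ln (real n + 1) / (2 * real n)) \<longlonglongrightarrow> 0" by real_asymp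
    show "?G \<longlonglongrightarrow> 0" by (rule average_height_gap_tendsto_0[OF _ ev]) (use \<tau> in auto)
  qed
  then have lim: "(\<lambda>n. ?a n + 1 * ?G n) \<longlonglongrightarrow> 0" by simp
  show ?thesis
  proof (rule tendsto_sandwich[OF _ _ tendsto_const lim])
    show "\<forall>\<^sub>F n in sequentially. 0 \<le> ?A n" by (intro always_eventually allI average_nonneg) simp
    show "\<forall>\<^sub>F n in sequentially. ?A n \<le> ?a n + 1 * ?G n"
      using eventually_ge_at_top[of 1]
    proof eventually_elim
      case (elim n)
      have "?A n \<le> average (bounded_int_polys n (r n)) (\<lambda>P. ?a n + 1 * (LINT w|fs_measure. height_gap 1 n (r n) P w))"
      proof (rule average_mono)
        fix P assume "P \<in> bounded_int_polys n (r n)"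
        from h_FS_estimate[OF elim this, of 1]
        show "\<bar>\<tau> + 1 / 2 - h_FS (complex_of_int_poly P)\<bar> \<le> ?a n + 1 * (LINT w|fs_measure. height_gap 1 n (r n) P w)"
          by linarith
      qed
      also have "\<dots> \<le> ?a n + 1 * ?G n" by (intro average_affine_le) simp
      finally show ?case .
    qed
  qed
qed

theorem corollary1p8:
  fixes r :: "nat \<Rightarrow> real"
  shows
    "(\<forall>\<tau>::real. 0 < \<tau> \<and> r \<longlonglongrightarrow> \<tau> \<longrightarrow>
        (\<lambda>n. 1 / real (card (bounded_int_polys n (r n))) *
          (\<Sum>P\<in>bounded_int_polys n (r n). \<bar>\<tau> + 1 / 2 - h_FS (complex_of_int_poly P)\<bar>))
        \<longlonglongrightarrow> 0) \<and>
     (0 < liminf (\<lambda>n. ereal (r n)) \<and>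
      liminf (\<lambda>n. ereal (r n)) \<le> limsup (\<lambda>n. ereal (r n)) \<and>
      limsup (\<lambda>n. ereal (r n)) < \<infinity> \<longrightarrow>
        (\<forall>f :: complex \<Rightarrow> complex.
          continuous_on UNIV f \<and> (\<exists>l. (f \<longlongrightarrow> l) at_infinity) \<longrightarrow>
            (\<lambda>n. 1 / real (card (bounded_int_polys n (r n))) *
              (\<Sum>P\<in>bounded_int_polys n (r n).
                cmod (1 / of_nat n * (\<Sum>z\<in>#proots (complex_of_int_poly P). f z) - FS_integral f)))
            \<longlonglongrightarrow> 0 \<and>
            (\<lambda>n. 1 / of_nat (card (bounded_int_polys n (r n))) *
              (\<Sum>P\<in>bounded_int_polys n (r n).
                1 / of_nat n * (\<Sum>z\<in>#proots (complex_of_int_poly P). f z)))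
            \<longlonglongrightarrow> FS_integral f))"
proof (intro conjI allI impI)
  fix \<tau> :: real assume "0 < \<tau> \<and> r \<longlonglongrightarrow> \<tau>"
  then show "(\<lambda>n. 1 / real (card (bounded_int_polys n (r n))) *
          (\<Sum>P\<in>bounded_int_polys n (r n). \<bar>\<tau> + 1 / 2 - h_FS (complex_of_int_poly P)\<bar>)) \<longlonglongrightarrow> 0"
    using average_h_FS_tendsto_0[of \<tau> r] by (simp add: average_def)
next
  fix f :: "complex \<Rightarrow> complex"
  assume r: "0 < liminf (\<lambda>n. ereal (r n)) \<and>
      liminf (\<lambda>n. ereal (r n)) \<le> limsup (\<lambda>n. ereal (r n)) \<and>
      limsup (\<lambda>n. ereal (r n)) < \<infinity>"
    and f: "continuous_on UNIV f \<and> (\<exists>l. (f \<longlongrightarrow> l) at_infinity)"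
  obtain c where c: "0 < ereal c" "ereal c < liminf (\<lambda>n. ereal (r n))" using r ereal_dense2 by blast
  obtain C where C: "limsup (\<lambda>n. ereal (r n)) < ereal C" using r ereal_dense2 by blast
  have "\<forall>\<^sub>F n in sequentially. ereal c < ereal (r n)" using c(2) by (rule less_LiminfD)
  moreover have "\<forall>\<^sub>F n in sequentially. ereal (r n) < ereal C" using C by (rule Limsup_lessD)
  ultimately have ev: "\<forall>\<^sub>F n in sequentially. c \<le> r n \<and> r n \<le> C" by eventually_elim auto
  have c0: "0 < c" using c by simp
  let ?X = "\<lambda>n. bounded_int_polys n (r n)"
  let ?m = "\<lambda>n P. 1 / of_nat n * (\<Sum>z\<in>#proots (complex_of_int_poly P). f z)"
  have A: "(\<lambda>n. average (?X n) (\<lambda>P. cmod (?m n P - FS_integral f))) \<longlonglongrightarrow> 0"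
    using f average_root_discrepancy_tendsto_0[OF c0 ev] by blast
  then show "(\<lambda>n. 1 / real (card (?X n)) * (\<Sum>P\<in>?X n. cmod (?m n P - FS_integral f))) \<longlonglongrightarrow> 0"
    by (simp add: average_def)
  show "(\<lambda>n. 1 / of_nat (card (?X n)) * (\<Sum>P\<in>?X n. ?m n P)) \<longlonglongrightarrow> FS_integral f"
  proof (rule LIM_zero_cancel, rule Lim_null_comparison[OF _ A])
    show "\<forall>\<^sub>F n in sequentially. cmod (1 / of_nat (card (?X n)) * (\<Sum>P\<in>?X n. ?m n P) - FS_integral f)
        \<le> average (?X n) (\<lambda>P. cmod (?m n P - FS_integral f))"
      using ev eventually_ge_at_top[of 1]
    proof eventually_elim
      case (elim n)
      \<comment> \<open>Only over a nonempty set is the average of the constant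
        \<open>FS_integral f\<close> that constant; the triangle inequality then reduces the claim
        to the limit already shown.\<close>
      then have card: "0 < card (?X n)" using c0 by (intro card_bounded_int_polys_pos) auto
      have "1 / of_nat (card (?X n)) * (\<Sum>P\<in>?X n. ?m n P) - FS_integral f
          = 1 / of_nat (card (?X n)) * (\<Sum>P\<in>?X n. ?m n P - FS_integral f)"
        using card by (simp add: sum_subtractf field_simps)
      then show ?case
        using norm_sum[of "\<lambda>P. ?m n P - FS_integral f" "?X n"]
        by (simp add: average_def norm_mult norm_divide divide_right_mono)
    qed
  qed
qed

end
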